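(* Let $A$ be a linearly ordered alphabet with $|A|=k$. The group $\mathrm{lp}T_{k,1}=T_{k,1}\cap\mathrm{lp}G_{k,1}$ is isomorphic to the $k^\infty$ Prüfer group, given by the direct limit of the sequence of embeddings $\mathbb{Z}_{A^n}\hookrightarrow\mathbb{Z}_{A^{n+1}}$ ($n\ge1$), where the embeddings are determined by the restriction operation of $G_{k,1}$, i.e., $\pi\mapsto\pi\otimes\mathrm{id}_A$, where $(\pi\otimes\mathrm{id}_A)(xa)=\pi(x)a$ for $x\in A^n$, $a\in A$.
   Context: Fix a finite linearly ordered alphabet $A$ with $|A|=k\ge 2$; $A^*$ is the set of finite words over $A$, $A^n$ the set of words of length $n$. A right ideal of $A^*$ is a set $R$ with $RA^*\subseteq R$; it is essential if it meets every non-empty right ideal. Every right ideal has a unique minimal generating set, which is a prefix code; it is a maximal prefix code iff the right ideal is essential. An isomorphism $\varphi:R_1\to R_2$ between right ideals is a bijection with $\varphi(rz)=\varphi(r)z$ for all $r\in R_1$, $z\in A^*$. Every isomorphism between finitely generated essential right ideals has a unique maximal extension to an isomorphism between essential right ideals. $G_{k,1}$ is the group of all maximally extended isomorphisms between finitely generated essential right ideals of $A^*$, with multiplication: composition followed by maximal extension. A bijection between finite maximal prefix codes represents the element of $G_{k,1}$ whose associated right-ideal isomorphism extends it. $\mathrm{lp}G_{k,1}$ is the subgroup of $\varphi\in G_{k,1}$ with $|\varphi(x)|=|x|$ for all $x\in \mathrm{Dom}(\varphi)$. A cyclical order of a finite maximal prefix code $P$ is a listing of $P$ that is a cyclic permutation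 of the listing of $P$ in dictionary order. $T_{k,1}$ is the subgroup of those $\varphi\in G_{k,1}$ that cyclically preserve the dictionary order: for all finite sequences $(x_0,\dots,x_{n-1})$ in $\mathrm{Dom}(\varphi)$, $(x_0,\dots,x_{n-1})$ is a cyclical order of some finite maximal prefix code iff $(\varphi(x_0),\dots,\varphi(x_{n-1}))$ is. $\mathbb{Z}_{A^n}$ is the cyclic subgroup of the symmetric group on $A^n$ generated by $w_i\mapsto w_{(i+1)\bmod k^n}$, where $(w_0,\dots,w_{k^n-1})$ lists $A^n$ in dictionary order. The $k^\infty$ Prüfer group is the group of all complex $k^n$-th roots of unity ($n>0$), equivalently $\{m/k^n \bmod 1: n,m\in\mathbb{N}\}$ under addition. *)

theory Defs
  imports Complex_Main "HOL-Algebra.Elementary_Groups" "HOL-Algebra.Bij"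
    "HOL-Library.Cardinality" "HOL-Library.Sublist" "HOL-Library.List_Lexorder"
begin

text \<open>
  The alphabet is a type of sorts \<open>finite\<close> and \<open>linorder\<close>; words are lists, and
  the linear order on words is the dictionary order of \<open>List_Lexorder\<close>.
\<close>

section \<open>Right ideals and prefix codes\<close>

definition right_ideal :: "'a list set \<Rightarrow> bool" where
  "right_ideal R \<longleftrightarrow> (\<forall>r\<in>R. \<forall>z. r @ z \<in> R)"

definition essential :: "'a list set \<Rightarrow> bool" where
  "essential R \<longleftrightarrow> right_ideal R \<and> (\<forall>S. right_ideal S \<and> S \<noteq> {} \<longrightarrow> R \<inter> S \<noteq> {})"

definition ideal_gen :: "'a list set \<Rightarrow> 'a list set" where
  "ideal_gen P = {p @ z | p z. p \<in> P}"

definition fg_essential :: "'a list set \<Rightarrow> bool" where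
  "fg_essential R \<longleftrightarrow> essential R \<and> (\<exists>P. finite P \<and> R = ideal_gen P)"

definition prefix_code :: "'a list set \<Rightarrow> bool" where
  "prefix_code P \<longleftrightarrow> (\<forall>p\<in>P. \<forall>q\<in>P. prefix p q \<longrightarrow> p = q)"

definition max_prefix_code :: "'a list set \<Rightarrow> bool" where
  "max_prefix_code P \<longleftrightarrow> prefix_code P \<and> (\<forall>Q. prefix_code Q \<and> P \<subseteq> Q \<longrightarrow> Q = P)"

section \<open>The Higman--Thompson group \<open>G_{k,1}\<close>\<close>

text \<open>
  Right ideal isomorphisms are partial functions on words (maps), so that extension of
  isomorphisms is the library relation \<open>\<subseteq>\<^sub>m\<close>.
\<close>

definition ideal_iso :: "('a list \<rightharpoonup> 'a list) \<Rightarrow> 'a list set \<Rightarrow> 'a list set \<Rightarrow> bool" where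
  "ideal_iso \<phi> R1 R2 \<longleftrightarrow> right_ideal R1 \<and> right_ideal R2 \<and> dom \<phi> = R1 \<and>
     bij_betw (\<lambda>r. the (\<phi> r)) R1 R2 \<and>
     (\<forall>r\<in>R1. \<forall>z. the (\<phi> (r @ z)) = the (\<phi> r) @ z)"

definition essential_iso :: "('a list \<rightharpoonup> 'a list) \<Rightarrow> bool" where
  "essential_iso \<phi> \<longleftrightarrow> (\<exists>R1 R2. essential R1 \<and> essential R2 \<and> ideal_iso \<phi> R1 R2)"

definition fg_essential_iso :: "('a list \<rightharpoonup> 'a list) \<Rightarrow> bool" where
  "fg_essential_iso \<phi> \<longleftrightarrow> (\<exists>R1 R2. fg_essential R1 \<and> fg_essential R2 \<and> ideal_iso \<phi> R1 R2)"

definition maximally_extended :: "('a list \<rightharpoonup> 'a list) \<Rightarrow> bool" where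
  "maximally_extended \<phi> \<longleftrightarrow> essential_iso \<phi> \<and> (\<forall>\<psi>. essential_iso \<psi> \<and> \<phi> \<subseteq>\<^sub>m \<psi> \<longrightarrow> \<psi> = \<phi>)"

definition max_ext :: "('a list \<rightharpoonup> 'a list) \<Rightarrow> ('a list \<rightharpoonup> 'a list)" where
  "max_ext \<phi> = (THE \<psi>. \<phi> \<subseteq>\<^sub>m \<psi> \<and> maximally_extended \<psi>)"

definition Gk1 :: "('a::finite list \<rightharpoonup> 'a list) monoid" where
  "Gk1 = \<lparr>carrier = {\<phi>. fg_essential_iso \<phi> \<and> maximally_extended \<phi>},
          monoid.mult = (\<lambda>\<phi> \<psi>. max_ext (\<phi> \<circ>\<^sub>m \<psi>)),
          one = Some\<rparr>"

text \<open>The isomorphism \<open>PA\<^sup>* \<rightarrow> QA\<^sup>*\<close> extending a bijection \<open>f : P \<rightarrow> Q\<close> between prefix codes.\<close>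

definition ideal_ext :: "'a list set \<Rightarrow> ('a list \<Rightarrow> 'a list) \<Rightarrow> ('a list \<rightharpoonup> 'a list)" where
  "ideal_ext P f = (\<lambda>w. if w \<in> ideal_gen P
     then let p = (THE p. p \<in> P \<and> prefix p w) in Some (f p @ drop (length p) w)
     else None)"

definition represented :: "'a list set \<Rightarrow> ('a list \<Rightarrow> 'a list) \<Rightarrow> ('a list \<rightharpoonup> 'a list)" where
  "represented P f = max_ext (ideal_ext P f)"

section \<open>The subgroups \<open>lpG_{k,1}\<close>, \<open>T_{k,1}\<close> and \<open>lpT_{k,1}\<close>\<close>

definition lpG :: "('a::finite list \<rightharpoonup> 'a list) set" where
  "lpG = {\<phi> \<in> carrier Gk1. \<forall>x\<in>dom \<phi>. length (the (\<phi> x)) = length x}"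

definition cyclical_order :: "'a::linorder list set \<Rightarrow> 'a list list \<Rightarrow> bool" where
  "cyclical_order P xs \<longleftrightarrow> (\<exists>m. xs = rotate m (sorted_list_of_set P))"

definition is_code_cycle :: "'a::linorder list list \<Rightarrow> bool" where
  "is_code_cycle xs \<longleftrightarrow> (\<exists>P. finite P \<and> max_prefix_code P \<and> cyclical_order P xs)"

definition Tk1 :: "('a::{finite,linorder} list \<rightharpoonup> 'a list) set" where
  "Tk1 = {\<phi> \<in> carrier Gk1. \<forall>xs. set xs \<subseteq> dom \<phi> \<longrightarrow>
            (is_code_cycle xs \<longleftrightarrow> is_code_cycle (map (\<lambda>x. the (\<phi> x)) xs))}"

definition lpT :: "('a::{finite,linorder} list \<rightharpoonup> 'a list) monoid" where
  "lpT = Gk1\<lparr>carrier := Tk1 \<inter> lpG\<rparr>"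

section \<open>The cyclic groups on words of length \<open>n\<close>\<close>

definition words :: "nat \<Rightarrow> 'a list set" where
  "words n = {w. length w = n}"

definition word_shift :: "nat \<Rightarrow> 'a::{finite,linorder} list \<Rightarrow> 'a list" where
  "word_shift n = (let ws = sorted_list_of_set (words n); N = CARD('a) ^ n in
     (\<lambda>w\<in>words n. ws ! ((inv_into {..<N} ((!) ws) w + 1) mod N)))"

definition ZA :: "nat \<Rightarrow> ('a::{finite,linorder} list \<Rightarrow> 'a list) monoid" where
  "ZA n = subgroup_generated (BijGroup (words n)) {word_shift n}"

definition tensor_id :: "nat \<Rightarrow> ('a list \<Rightarrow> 'a list) \<Rightarrow> ('a list \<Rightarrow> 'a list)" where
  "tensor_id n \<pi> = (\<lambda>w\<in>words (Suc n). \<pi> (butlast w) @ [last w])"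

section \<open>Direct limits of sequences of groups\<close>

text \<open>
  For homomorphisms \<open>f n : G n \<rightarrow> G (Suc n)\<close>, the direct limit is the disjoint union of
  the \<open>G n\<close> modulo eventual equality.
\<close>

definition transition :: "(nat \<Rightarrow> 'b \<Rightarrow> 'b) \<Rightarrow> nat \<Rightarrow> nat \<Rightarrow> 'b \<Rightarrow> 'b" where
  "transition f m n = fold f [m..<n]"

definition dirlim_rel ::
  "(nat \<Rightarrow> 'b monoid) \<Rightarrow> (nat \<Rightarrow> 'b \<Rightarrow> 'b) \<Rightarrow> ((nat \<times> 'b) \<times> (nat \<times> 'b)) set" where
  "dirlim_rel G f = {((m, x), (n, y)). x \<in> carrier (G m) \<and> y \<in> carrier (G n) \<and>
     (\<exists>l. m \<le> l \<and> n \<le> l \<and> transition f m l x = transition f n l y)}"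

definition dirlim_in ::
  "(nat \<Rightarrow> 'b monoid) \<Rightarrow> (nat \<Rightarrow> 'b \<Rightarrow> 'b) \<Rightarrow> nat \<Rightarrow> 'b \<Rightarrow> (nat \<times> 'b) set" where
  "dirlim_in G f n x = dirlim_rel G f `` {(n, x)}"

definition direct_limit ::
  "(nat \<Rightarrow> 'b monoid) \<Rightarrow> (nat \<Rightarrow> 'b \<Rightarrow> 'b) \<Rightarrow> (nat \<times> 'b) set monoid" where
  "direct_limit G f =
    \<lparr>carrier = (SIGMA n:UNIV. carrier (G n)) // dirlim_rel G f,
     monoid.mult = (\<lambda>X Y. \<Union>(m, x)\<in>X. \<Union>(n, y)\<in>Y.
        dirlim_in G f (max m n)
          (transition f m (max m n) x \<otimes>\<^bsub>G (max m n)\<^esub> transition f n (max m n) y)),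
     one = dirlim_in G f 0 \<one>\<^bsub>G 0\<^esub>\<rparr>"

section \<open>The Pruefer group\<close>

definition prufer :: "nat \<Rightarrow> complex monoid" where
  "prufer k = \<lparr>carrier = {z. \<exists>n>0. z ^ (k ^ n) = 1}, monoid.mult = (*), one = 1\<rparr>"

end

(* An element of lpT permutes the words of some length n, and preserving
   cyclical orders of the code of all words of length n forces this permutation to be a rotation of
   the dictionary listing. Conversely, a rotation on length n induces a rotation on every length
   N >= n, and cyclical orders of arbitrary maximal prefix codes are detected on such a length N.
   Hence lpT is the increasing union of the images of the groups ZA n. A compatible family of
   injective homomorphisms into one group identifies the direct limit with the union of the images;
   applied once to Gk1 and once to the Pruefer group, this gives both isomorphisms. *)

theory Submission
  imports Defs
begin

section \<open>Maximal extensions and the Higman--Thompson group\<close>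

text \<open>Elements of \<open>Gk1\<close> are maximally extended, so their domains are not explicit
  and every product has to be extended again. The remedy is to compute with unextended
  representatives: restricting an isomorphism to a smaller essential right ideal does not change its
  maximal extension, so group laws become laws of partial composition. The obstacle in the condition
  defining \<open>Tk1\<close> is the quantifier over all codes. Replacing each word by the block of
  its extensions of one length \<open>N\<close> turns "cyclical order of some code" into the single
  question whether a list is a rotation of the listing of \<open>words N\<close>; that the original
  words form a code is recovered from the distinctness of that list. The Pruefer group enters
  because each word has \<open>k\<close> one-letter extensions: \<open>tensor_id\<close> sends
  rotation by \<open>m\<close> to rotation by \<open>m * k\<close>, and
  \<open>m / k^n = (m * k) / k^(n+1)\<close>. That \<open>Tk1 \<inter> lpG\<close> is a subgroup is
  not checked on its defining conditions; it is inherited from the union of the images.\<close>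

lemma essential_iff: "essential R \<longleftrightarrow> right_ideal R \<and> (\<forall>w. \<exists>z. w @ z \<in> R)"
proof -
  have "R \<inter> S \<noteq> {}" if "\<forall>w. \<exists>z. w @ z \<in> R" "right_ideal S" "S \<noteq> {}" for S
    using that unfolding right_ideal_def by blast
  moreover have "\<exists>z. w @ z \<in> R"
    if "\<forall>S. right_ideal S \<and> S \<noteq> {} \<longrightarrow> R \<inter> S \<noteq> {}" for w
  proof -
    \<comment> \<open>Essentiality is tested on the principal right ideal of
      \<open>w\<close>.\<close>
    have "right_ideal {w @ z | z. True}" "{w @ z | z. True} \<noteq> {}"
      by (auto simp: right_ideal_def)
    then show ?thesis using that by blast
  qed
  ultimately show ?thesis unfolding essential_def by blast
qed

lemma in_words_iff: "w \<in> words n \<longleftrightarrow> length w = n"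
  by (simp add: words_def)

lemma finite_words: "finite (words n :: 'a::finite list set)"
  using finite_lists_length_eq[of "UNIV :: 'a set" n] by (simp add: words_def)

text \<open>By essentiality a word \<open>w\<close> at least as long as every generator has an
  extension in \<open>R\<close>; the generator starting that extension is no longer than
  \<open>w\<close>, hence a prefix of \<open>w\<close>. Conversely, the words of \<open>R\<close> up
  to the threshold length generate \<open>R\<close>. Closure under enlargement, converse and
  composition thus becomes a matter of length bounds.\<close>

lemma fg_essential_iff:
  fixes R :: "'a::finite list set"
  shows "fg_essential R \<longleftrightarrow> right_ideal R \<and> (\<exists>n. \<forall>w. n \<le> length w \<longrightarrow> w \<in> R)"
proof
  assume R: "fg_essential R"
  then obtain P where P: "finite P" "R = ideal_gen P" and ess: "essential R"
    unfolding fg_essential_def by blast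
  define n where "n = (\<Sum>p\<in>P. length p)"
  have "w \<in> R" if w: "n \<le> length w" for w
  proof -
    obtain z p z' where p: "p \<in> P" "w @ z = p @ z'"
      using ess P(2) unfolding essential_iff ideal_gen_def by blast
    have "length p \<le> length w"
      using member_le_sum[of p P length] P(1) p(1) w by (simp add: n_def)
    then obtain u where "w = p @ u" using p(2) by (auto simp: append_eq_append_conv2)
    then show ?thesis using p(1) P(2) by (auto simp: ideal_gen_def)
  qed
  then show "right_ideal R \<and> (\<exists>n. \<forall>w. n \<le> length w \<longrightarrow> w \<in> R)"
    using ess essential_iff by blast
next
  assume "right_ideal R \<and> (\<exists>n. \<forall>w. n \<le> length w \<longrightarrow> w \<in> R)"
  then obtain n where R: "right_ideal R" and n: "\<And>w. n \<le> length w \<Longrightarrow> w \<in> R" by blast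
  have ess: "essential R"
    unfolding essential_iff
  proof (intro conjI allI R)
    fix w
    show "\<exists>z. w @ z \<in> R" by (rule exI[of _ "replicate n undefined"]) (simp add: n)
  qed
  have "R = ideal_gen {w \<in> R. length w \<le> n}"
  proof
    show "R \<subseteq> ideal_gen {w \<in> R. length w \<le> n}"
    proof
      fix w assume w: "w \<in> R"
      show "w \<in> ideal_gen {w \<in> R. length w \<le> n}"
      proof (cases "length w \<le> n")
        case True
        then show ?thesis using w unfolding ideal_gen_def by force
      next
        case False
        then have "take n w \<in> R" "length (take n w) \<le> n" using n by auto
        moreover have "w = take n w @ drop n w" by simp
        ultimately show ?thesis unfolding ideal_gen_def by blast
      qed
    qed
    show "ideal_gen {w \<in> R. length w \<le> n} \<subseteq> R"
      using R by (auto simp: ideal_gen_def right_ideal_def)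
  qed
  moreover have "finite {w \<in> R. length w \<le> n}"
    by (rule finite_subset[OF _ finite_lists_length_le[of "UNIV :: 'a set" n]]) auto
  ultimately show "fg_essential R" unfolding fg_essential_def using ess by blast
qed

lemma fg_essential_mono:
  fixes R :: "'a::finite list set"
  assumes "fg_essential R" "R \<subseteq> S" "right_ideal S"
  shows "fg_essential S"
  using assms unfolding fg_essential_iff by blast

text \<open>Phrased through \<open>Some\<close>, the equations themselves carry membership in the
  domain, which suits composites and converses.\<close>

lemma ideal_iso_iff:
  "ideal_iso \<phi> R1 R2 \<longleftrightarrow> right_ideal R1 \<and> right_ideal R2 \<and> dom \<phi> = R1 \<and> ran \<phi> = R2 \<and>
     (\<forall>x x' y. \<phi> x = Some y \<longrightarrow> \<phi> x' = Some y \<longrightarrow> x = x') \<and>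
     (\<forall>x y z. \<phi> x = Some y \<longrightarrow> \<phi> (x @ z) = Some (y @ z))" (is "?L \<longleftrightarrow> ?R")
proof
  assume L: ?L
  then have bij: "bij_betw (\<lambda>r. the (\<phi> r)) (dom \<phi>) R2" and r: "right_ideal R1" "right_ideal R2"
    and d: "dom \<phi> = R1" and e: "\<And>r z. r \<in> dom \<phi> \<Longrightarrow> the (\<phi> (r @ z)) = the (\<phi> r) @ z"
    by (auto simp: ideal_iso_def)
  have "ran \<phi> = (\<lambda>r. the (\<phi> r)) ` dom \<phi>" by (force simp: ran_def dom_def)
  then have "ran \<phi> = R2" using bij by (simp add: bij_betw_def)
  moreover have "x = x'" if "\<phi> x = Some y" "\<phi> x' = Some y" for x x' y
    using inj_onD[of "\<lambda>r. the (\<phi> r)" "dom \<phi>" x x'] bij that by (auto simp: bij_betw_def)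
  moreover have "\<phi> (x @ z) = Some (y @ z)" if "\<phi> x = Some y" for x y z
  proof -
    have "x \<in> dom \<phi>" using that by blast
    then have "x @ z \<in> dom \<phi>" using r d by (auto simp: right_ideal_def)
    then show ?thesis using e[OF \<open>x \<in> dom \<phi>\<close>, of z] that by auto
  qed
  ultimately show ?R using r d by blast
next
  assume R: ?R
  have "inj_on (\<lambda>r. the (\<phi> r)) (dom \<phi>)"
  proof (rule inj_onI)
    fix x x' assume "x \<in> dom \<phi>" "x' \<in> dom \<phi>" "the (\<phi> x) = the (\<phi> x')"
    then have "\<phi> x = Some (the (\<phi> x))" "\<phi> x' = Some (the (\<phi> x))" by auto
    then show "x = x'" using R by blast
  qed
  moreover have "ran \<phi> = (\<lambda>r. the (\<phi> r)) ` dom \<phi>" by (force simp: ran_def dom_def)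
  ultimately have "bij_betw (\<lambda>r. the (\<phi> r)) R1 R2" using R by (auto simp: bij_betw_def)
  moreover have "the (\<phi> (r @ z)) = the (\<phi> r) @ z" if "r \<in> R1" for r z
  proof -
    have "r \<in> dom \<phi>" using that R by simp
    then obtain y where y: "\<phi> r = Some y" by blast
    then have "\<phi> (r @ z) = Some (y @ z)" using R by blast
    then show ?thesis using y by simp
  qed
  ultimately show ?L using R by (simp add: ideal_iso_def)
qed

lemma essential_isoD:
  assumes "essential_iso \<phi>"
  shows "\<exists>z. x @ z \<in> dom \<phi>" and "\<exists>z. x @ z \<in> ran \<phi>"
    and "\<phi> x = Some y \<Longrightarrow> \<phi> x' = Some y \<Longrightarrow> x = x'"
    and "\<phi> x = Some y \<Longrightarrow> \<phi> (x @ z) = Some (y @ z)"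
  using assms by (auto simp: essential_iso_def ideal_iso_iff essential_iff)

lemma right_ideal_dom_ran:
  assumes "\<And>x y z. \<phi> x = Some y \<Longrightarrow> \<phi> (x @ z) = Some (y @ z)"
  shows "right_ideal (dom \<phi>)" "right_ideal (ran \<phi>)"
  using assms unfolding right_ideal_def dom_def ran_def by blast+

lemma essential_isoI:
  assumes "\<And>x. \<exists>z. x @ z \<in> dom \<phi>" and "\<And>x. \<exists>z. x @ z \<in> ran \<phi>"
    and "\<And>x x' y. \<phi> x = Some y \<Longrightarrow> \<phi> x' = Some y \<Longrightarrow> x = x'"
    and e: "\<And>x y z. \<phi> x = Some y \<Longrightarrow> \<phi> (x @ z) = Some (y @ z)"
  shows "essential_iso \<phi>"
  unfolding essential_iso_def
proof (intro exI conjI)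
  show "essential (dom \<phi>)" "essential (ran \<phi>)"
    using assms right_ideal_dom_ran[of \<phi>, OF e] by (auto simp: essential_iff)
  show "ideal_iso \<phi> (dom \<phi>) (ran \<phi>)"
    unfolding ideal_iso_iff using assms(3,4) right_ideal_dom_ran[of \<phi>, OF e] by blast
qed

lemma fg_essential_iso_iff:
  "fg_essential_iso \<phi> \<longleftrightarrow> essential_iso \<phi> \<and> fg_essential (dom \<phi>) \<and> fg_essential (ran \<phi>)"
  unfolding fg_essential_iso_def essential_iso_def ideal_iso_iff by (auto simp: fg_essential_def)

lemma fg_essential_isoI:
  fixes \<phi> :: "'a::finite list \<rightharpoonup> 'a list"
  assumes "\<And>w. n \<le> length w \<Longrightarrow> w \<in> dom \<phi>" and "\<And>w. m \<le> length w \<Longrightarrow> w \<in> ran \<phi>"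
    and "\<And>x x' y. \<phi> x = Some y \<Longrightarrow> \<phi> x' = Some y \<Longrightarrow> x = x'"
    and "\<And>x y z. \<phi> x = Some y \<Longrightarrow> \<phi> (x @ z) = Some (y @ z)"
  shows "fg_essential_iso \<phi>"
proof -
  note r = right_ideal_dom_ran[of \<phi>, OF assms(4)]
  have fg: "fg_essential (dom \<phi>)" "fg_essential (ran \<phi>)"
    unfolding fg_essential_iff using r assms(1,2) by fast+
  then have "ideal_iso \<phi> (dom \<phi>) (ran \<phi>)"
    unfolding ideal_iso_iff using assms(3,4) r by blast
  with fg show ?thesis unfolding fg_essential_iso_def by blast
qed

lemma fg_essential_isoD:
  fixes \<phi> :: "'a::finite list \<rightharpoonup> 'a list"
  assumes "fg_essential_iso \<phi>"
  shows "\<exists>n. \<forall>w. n \<le> length w \<longrightarrow> w \<in> dom \<phi> \<and> w \<in> ran \<phi>"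
proof -
  obtain n m where "\<And>w. n \<le> length w \<Longrightarrow> w \<in> dom \<phi>" "\<And>w. m \<le> length w \<Longrightarrow> w \<in> ran \<phi>"
    using assms unfolding fg_essential_iso_iff fg_essential_iff by blast
  then show ?thesis by (intro exI[of _ "max n m"]) simp
qed

lemma map_leI: "(\<And>x y. f x = Some y \<Longrightarrow> g x = Some y) \<Longrightarrow> f \<subseteq>\<^sub>m g"
  by (auto simp: map_le_def dom_def)

lemma map_leD: "f \<subseteq>\<^sub>m g \<Longrightarrow> f x = Some y \<Longrightarrow> g x = Some y"
  by (force simp: map_le_def)

section \<open>The greatest extension of an isomorphism\<close>

definition ext_at :: "('a list \<rightharpoonup> 'a list) \<Rightarrow> 'a list \<Rightarrow> 'a list \<Rightarrow> bool" where
  "ext_at \<phi> x y \<longleftrightarrow> (\<forall>z. x @ z \<in> dom \<phi> \<longrightarrow> \<phi> (x @ z) = Some (y @ z))"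

text \<open>The union of all extensions, given explicitly rather than by a chain argument:
  \<open>ext_at \<phi> x y\<close> is the constraint that \<open>\<phi>\<close> puts on a value
  \<open>y\<close> at \<open>x\<close>, and meeting these constraints already yields an
  isomorphism.\<close>

definition greatest_ext :: "('a list \<rightharpoonup> 'a list) \<Rightarrow> ('a list \<rightharpoonup> 'a list)" where
  "greatest_ext \<phi> x = (if \<exists>y. ext_at \<phi> x y then Some (SOME y. ext_at \<phi> x y) else None)"

text \<open>An essential domain contains some \<open>x @ z\<close>, and there the suffix
  cancels.\<close>

lemma ext_at_unique:
  assumes "essential_iso \<phi>" "ext_at \<phi> x y" "ext_at \<phi> x y'"
  shows "y = y'"
proof -
  obtain z where "x @ z \<in> dom \<phi>" using essential_isoD(1)[OF assms(1)] by blast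
  then have "Some (y @ z) = Some (y' @ z)" using assms(2,3) unfolding ext_at_def by metis
  then show ?thesis by simp
qed

lemma greatest_ext_eq_Some:
  assumes "essential_iso \<phi>"
  shows "greatest_ext \<phi> x = Some y \<longleftrightarrow> ext_at \<phi> x y"
  using ext_at_unique[OF assms] someI_ex[of "ext_at \<phi> x"]
  by (auto simp: greatest_ext_def)

text \<open>With \<open>\<psi> = \<phi>\<close> this is the extension property; with larger
  \<open>\<psi>\<close> it is maximality.\<close>

lemma map_le_greatest_ext:
  assumes "essential_iso \<phi>" "essential_iso \<psi>" "\<phi> \<subseteq>\<^sub>m \<psi>"
  shows "\<psi> \<subseteq>\<^sub>m greatest_ext \<phi>"
proof (rule map_leI)
  fix x y assume "\<psi> x = Some y"
  then have "ext_at \<phi> x y"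
    using essential_isoD(4)[OF assms(2)] assms(3) by (auto simp: ext_at_def map_le_def)
  then show "greatest_ext \<phi> x = Some y" by (simp add: greatest_ext_eq_Some assms(1))
qed

lemma essential_iso_greatest_ext:
  assumes "essential_iso \<phi>"
  shows "essential_iso (greatest_ext \<phi>)"
proof (rule essential_isoI)
  note le = map_le_greatest_ext[OF assms assms map_le_refl]
  note eq = greatest_ext_eq_Some[OF assms]
  show "\<exists>z. x @ z \<in> dom (greatest_ext \<phi>)" for x
    using essential_isoD(1)[OF assms, of x] map_le_implies_dom_le[OF le] by blast
  show "\<exists>z. x @ z \<in> ran (greatest_ext \<phi>)" for x
    using essential_isoD(2)[OF assms, of x] le by (fastforce simp: ran_def map_le_def dom_def)
  show "x = x'" if y: "greatest_ext \<phi> x = Some y" "greatest_ext \<phi> x' = Some y" for x x' y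
  proof -
    \<comment> \<open>Lengthen until both words lie in the domain: \<open>z\<close> serves
      \<open>x\<close>, and \<open>z'\<close> then serves \<open>x' @ z\<close> while
      \<open>x @ z @ z'\<close> stays inside. Injectivity of \<open>\<phi>\<close> applies
      there.\<close>
    obtain z where z: "x @ z \<in> dom \<phi>" using essential_isoD(1)[OF assms] by blast
    obtain z' where z': "(x' @ z) @ z' \<in> dom \<phi>" using essential_isoD(1)[OF assms] by blast
    have "\<phi> (x @ z) = Some (y @ z)" using y z by (simp add: eq ext_at_def)
    then have "\<phi> ((x @ z) @ z') = Some ((y @ z) @ z')" by (rule essential_isoD(4)[OF assms])
    moreover have "\<phi> ((x' @ z) @ z') = Some ((y @ z) @ z')"
      using y z' by (simp add: eq ext_at_def)
    ultimately have "(x @ z) @ z' = (x' @ z) @ z'" by (rule essential_isoD(3)[OF assms])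
    then show ?thesis by simp
  qed
  show "greatest_ext \<phi> (x @ z) = Some (y @ z)" if "greatest_ext \<phi> x = Some y" for x y z
    using that by (simp add: eq ext_at_def)
qed

lemma maximally_extended_greatest_ext:
  assumes "essential_iso \<phi>"
  shows "maximally_extended (greatest_ext \<phi>)"
  unfolding maximally_extended_def
proof (intro conjI allI impI)
  show "essential_iso (greatest_ext \<phi>)" by (rule essential_iso_greatest_ext[OF assms])
  fix \<psi> assume \<psi>: "essential_iso \<psi> \<and> greatest_ext \<phi> \<subseteq>\<^sub>m \<psi>"
  then have "\<phi> \<subseteq>\<^sub>m \<psi>"
    using map_le_trans map_le_greatest_ext[OF assms assms map_le_refl] by blast
  then show "\<psi> = greatest_ext \<phi>" using map_le_greatest_ext[OF assms] \<psi> map_le_antisym by blast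
qed

text \<open>A maximally extended map above \<open>\<phi>\<close> lies below
  \<open>greatest_ext \<phi>\<close>, so it coincides with it; this resolves the \<open>THE\<close>
  in \<open>max_ext\<close>.\<close>

lemma max_ext_unique:
  assumes "essential_iso \<phi>" "\<phi> \<subseteq>\<^sub>m \<psi>" "maximally_extended \<psi>"
  shows "max_ext \<phi> = \<psi>"
proof -
  have "\<chi> = greatest_ext \<phi>" if "\<phi> \<subseteq>\<^sub>m \<chi>" "maximally_extended \<chi>" for \<chi>
    using that map_le_greatest_ext[OF assms(1)] essential_iso_greatest_ext[OF assms(1)]
    unfolding maximally_extended_def by metis
  then show ?thesis using assms(2,3) unfolding max_ext_def by (blast intro: the_equality)
qed

lemma max_ext_eq_greatest_ext: "essential_iso \<phi> \<Longrightarrow> max_ext \<phi> = greatest_ext \<phi>"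
  by (intro max_ext_unique maximally_extended_greatest_ext map_le_greatest_ext) auto

lemma max_ext:
  assumes "essential_iso \<phi>"
  shows "essential_iso (max_ext \<phi>)" "\<phi> \<subseteq>\<^sub>m max_ext \<phi>" "maximally_extended (max_ext \<phi>)"
  using max_ext_eq_greatest_ext[OF assms] essential_iso_greatest_ext[OF assms]
    map_le_greatest_ext[OF assms assms] maximally_extended_greatest_ext[OF assms] by auto

text \<open>Passing to a smaller domain is invisible after maximal extension. This is what makes
  unextended representatives usable.\<close>

lemma max_ext_cong:
  assumes "essential_iso \<phi>" "essential_iso \<psi>" "\<phi> \<subseteq>\<^sub>m \<psi>"
  shows "max_ext \<phi> = max_ext \<psi>"
  using max_ext_unique[OF assms(1) map_le_trans[OF assms(3) max_ext(2)[OF assms(2)]]]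
    max_ext(3)[OF assms(2)] by simp

lemma fg_essential_iso_max_ext:
  fixes \<phi> :: "'a::finite list \<rightharpoonup> 'a list"
  assumes "fg_essential_iso \<phi>"
  shows "fg_essential_iso (max_ext \<phi>)"
proof -
  have \<phi>: "essential_iso \<phi>" and d: "fg_essential (dom \<phi>)" "fg_essential (ran \<phi>)"
    using assms by (auto simp: fg_essential_iso_iff)
  note m = max_ext[OF \<phi>]
  note r = right_ideal_dom_ran[of "max_ext \<phi>", OF essential_isoD(4)[OF m(1)]]
  have "dom \<phi> \<subseteq> dom (max_ext \<phi>)" "ran \<phi> \<subseteq> ran (max_ext \<phi>)"
    using m(2) by (force simp: ran_def map_le_def dom_def)+
  then show ?thesis using m(1) r d fg_essential_mono by (auto simp: fg_essential_iso_iff)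
qed

section \<open>Converses and composites of isomorphisms\<close>

definition converse_map :: "('b \<rightharpoonup> 'c) \<Rightarrow> ('c \<rightharpoonup> 'b)" where
  "converse_map \<phi> y = (if y \<in> ran \<phi> then Some (SOME x. \<phi> x = Some y) else None)"

lemma converse_map_eq_Some:
  assumes "essential_iso \<phi>"
  shows "converse_map \<phi> y = Some x \<longleftrightarrow> \<phi> x = Some y"
  using essential_isoD(3)[OF assms] someI_ex[of "\<lambda>x. \<phi> x = Some y"]
  by (auto simp: converse_map_def ran_def)

lemma fg_essential_iso_converse_map:
  fixes \<phi> :: "'a::finite list \<rightharpoonup> 'a list"
  assumes "fg_essential_iso \<phi>"
  shows "fg_essential_iso (converse_map \<phi>)"
proof -
  have \<phi>: "essential_iso \<phi>" using assms fg_essential_iso_iff by blast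
  note eq = converse_map_eq_Some[OF \<phi>]
  obtain n where n: "\<And>w. n \<le> length w \<Longrightarrow> w \<in> dom \<phi>" "\<And>w. n \<le> length w \<Longrightarrow> w \<in> ran \<phi>"
    using fg_essential_isoD[OF assms] by blast
  show ?thesis
  proof (rule fg_essential_isoI)
    show "w \<in> dom (converse_map \<phi>)" "w \<in> ran (converse_map \<phi>)" if "n \<le> length w" for w
      using n[OF that] unfolding dom_def ran_def mem_Collect_eq not_None_eq eq by blast+
    show "y = y'" if "converse_map \<phi> y = Some x" "converse_map \<phi> y' = Some x" for y y' x
      using that by (simp add: eq)
    show "converse_map \<phi> (y @ z) = Some (x @ z)" if "converse_map \<phi> y = Some x" for y x z
      using that essential_isoD(4)[OF \<phi>] by (simp add: eq)
  qed
qed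

text \<open>Only domains are computed: the range of the composite is the domain of the composite of
  the converses in opposite order, so the same bound is used twice.\<close>

lemma fg_essential_iso_comp:
  fixes \<phi> \<psi> :: "'a::finite list \<rightharpoonup> 'a list"
  assumes "fg_essential_iso \<phi>" "fg_essential_iso \<psi>"
  shows "fg_essential_iso (\<phi> \<circ>\<^sub>m \<psi>)"
proof -
  have e: "essential_iso \<chi>" if "fg_essential_iso \<chi>" for \<chi> :: "'a list \<rightharpoonup> 'a list"
    using that fg_essential_iso_iff by blast
  have d: "\<exists>n. \<forall>w. n \<le> length w \<longrightarrow> w \<in> dom (\<phi> \<circ>\<^sub>m \<psi>)"
    if "fg_essential_iso \<phi>" "fg_essential_iso \<psi>" for \<phi> \<psi> :: "'a list \<rightharpoonup> 'a list"
  proof -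
    obtain n where n: "\<And>w. n \<le> length w \<Longrightarrow> w \<in> dom \<phi>" using fg_essential_isoD[OF \<open>fg_essential_iso \<phi>\<close>] by blast
    obtain m where m: "\<And>w. m \<le> length w \<Longrightarrow> w \<in> dom \<psi>" using fg_essential_isoD[OF \<open>fg_essential_iso \<psi>\<close>] by blast
    note \<psi> = \<open>fg_essential_iso \<psi>\<close>
    \<comment> \<open>The first \<open>m\<close> letters bring \<open>w\<close> into the domain of
      \<open>\<psi>\<close>; the remaining letters, at least \<open>n\<close>, survive in the image
      and make it long enough for \<open>\<phi>\<close>.\<close>
    have "w \<in> dom (\<phi> \<circ>\<^sub>m \<psi>)" if w: "m + n \<le> length w" for w
    proof -
      obtain y where y: "\<psi> (take m w) = Some y" using m[of "take m w"] w by fastforce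
      then have "\<psi> w = Some (y @ drop m w)"
        using essential_isoD(4)[OF e[OF \<psi>] y, of "drop m w"] by simp
      moreover have "y @ drop m w \<in> dom \<phi>" using n w by simp
      ultimately show ?thesis by (auto simp: map_comp_Some_iff)
    qed
    then show ?thesis by blast
  qed
  obtain n where n: "\<And>w. n \<le> length w \<Longrightarrow> w \<in> dom (\<phi> \<circ>\<^sub>m \<psi>)" using d[OF assms] by blast
  obtain m where m: "\<And>w. m \<le> length w \<Longrightarrow> w \<in> dom (converse_map \<psi> \<circ>\<^sub>m converse_map \<phi>)"
    using d[OF assms(2,1)[THEN fg_essential_iso_converse_map]] by blast
  note \<phi> = e[OF assms(1)] and \<psi> = e[OF assms(2)]
  show ?thesis
  proof (rule fg_essential_isoI[OF n])
    show "w \<in> ran (\<phi> \<circ>\<^sub>m \<psi>)" if "m \<le> length w" for w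
    proof -
      obtain x where "(converse_map \<psi> \<circ>\<^sub>m converse_map \<phi>) w = Some x"
        using m[OF \<open>m \<le> length w\<close>] by blast
      then have "(\<phi> \<circ>\<^sub>m \<psi>) x = Some w"
        unfolding map_comp_Some_iff converse_map_eq_Some[OF \<phi>] converse_map_eq_Some[OF \<psi>] by blast
      then show ?thesis by (rule ranI)
    qed
    show "x = x'" if "(\<phi> \<circ>\<^sub>m \<psi>) x = Some y" "(\<phi> \<circ>\<^sub>m \<psi>) x' = Some y" for x x' y
      using that essential_isoD(3)[OF \<phi>] essential_isoD(3)[OF \<psi>] unfolding map_comp_Some_iff by metis
    show "(\<phi> \<circ>\<^sub>m \<psi>) (x @ z) = Some (y @ z)" if "(\<phi> \<circ>\<^sub>m \<psi>) x = Some y" for x y z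
      using that essential_isoD(4)[OF \<phi>] essential_isoD(4)[OF \<psi>] unfolding map_comp_Some_iff by metis
  qed
qed

section \<open>Group laws up to maximal extension\<close>

lemma Gk1_carrier_iff: "\<phi> \<in> carrier Gk1 \<longleftrightarrow> fg_essential_iso \<phi> \<and> maximally_extended \<phi>"
  by (simp add: Gk1_def)

lemma Gk1_mult: "\<phi> \<otimes>\<^bsub>Gk1\<^esub> \<psi> = max_ext (\<phi> \<circ>\<^sub>m \<psi>)"
  by (simp add: Gk1_def)

lemma Gk1_one: "\<one>\<^bsub>Gk1\<^esub> = Some"
  by (simp add: Gk1_def)

lemma max_ext_in_Gk1: "fg_essential_iso \<phi> \<Longrightarrow> max_ext \<phi> \<in> carrier Gk1"
  using fg_essential_iso_max_ext max_ext(3) by (auto simp: Gk1_carrier_iff fg_essential_iso_iff)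

lemma map_comp_mono: "f \<subseteq>\<^sub>m f' \<Longrightarrow> g \<subseteq>\<^sub>m g' \<Longrightarrow> f \<circ>\<^sub>m g \<subseteq>\<^sub>m f' \<circ>\<^sub>m g'"
  by (rule map_leI) (auto simp: map_comp_Some_iff map_le_def dom_def)

text \<open>The composite of the representatives is a restriction of the composite of their maximal
  extensions.\<close>

lemma max_ext_mult_max_ext:
  fixes \<phi> \<psi> :: "'a::finite list \<rightharpoonup> 'a list"
  assumes "fg_essential_iso \<phi>" "fg_essential_iso \<psi>"
  shows "max_ext \<phi> \<otimes>\<^bsub>Gk1\<^esub> max_ext \<psi> = max_ext (\<phi> \<circ>\<^sub>m \<psi>)"
proof -
  have e: "essential_iso \<chi>" if "fg_essential_iso \<chi>" for \<chi> :: "'a list \<rightharpoonup> 'a list"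
    using that fg_essential_iso_iff by blast
  show ?thesis unfolding Gk1_mult
    by (rule max_ext_cong[symmetric])
      (use assms in \<open>auto intro!: e fg_essential_iso_comp fg_essential_iso_max_ext map_comp_mono max_ext(2)\<close>)
qed

lemma max_ext_maximally_extended: "maximally_extended \<phi> \<Longrightarrow> max_ext \<phi> = \<phi>"
  using max_ext_unique map_le_refl unfolding maximally_extended_def by blast

text \<open>A total map has no proper extension, so the identity is maximally extended.\<close>

lemma max_ext_restrict_id:
  assumes "essential_iso \<phi>" "\<phi> \<subseteq>\<^sub>m Some"
  shows "max_ext \<phi> = Some"
proof (rule max_ext_unique[OF assms])
  have "essential_iso (Some :: 'a list \<rightharpoonup> 'a list)"
    by (rule essential_isoI) (auto simp: ran_def)
  moreover have "\<psi> = Some" if "Some \<subseteq>\<^sub>m \<psi>" for \<psi> :: "'a list \<rightharpoonup> 'a list"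
    using that by (auto simp: map_le_def fun_eq_iff)
  ultimately show "maximally_extended (Some :: 'a list \<rightharpoonup> 'a list)"
    by (auto simp: maximally_extended_def)
qed

lemma fg_essential_iso_Some: "fg_essential_iso (Some :: 'a::finite list \<rightharpoonup> 'a list)"
  by (rule fg_essential_isoI[of 0 _ 0]) (auto simp: ran_def)

theorem group_Gk1: "group (Gk1 :: ('a::finite list \<rightharpoonup> 'a list) monoid)"
proof (rule groupI)
  let ?G = "Gk1 :: ('a list \<rightharpoonup> 'a list) monoid"
  have e: "essential_iso \<chi>" if "fg_essential_iso \<chi>" for \<chi> :: "'a list \<rightharpoonup> 'a list"
    using that fg_essential_iso_iff by blast
  show "\<phi> \<otimes>\<^bsub>?G\<^esub> \<psi> \<in> carrier ?G" if "\<phi> \<in> carrier ?G" "\<psi> \<in> carrier ?G" for \<phi> \<psi>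
    using that by (auto simp: Gk1_carrier_iff Gk1_mult
        intro!: fg_essential_iso_max_ext max_ext(3) fg_essential_iso_comp e)
  have "max_ext Some = (Some :: 'a list \<rightharpoonup> 'a list)"
    by (intro max_ext_restrict_id e fg_essential_iso_Some map_le_refl)
  then show "\<one>\<^bsub>?G\<^esub> \<in> carrier ?G"
    using max_ext_in_Gk1[OF fg_essential_iso_Some] by (metis Gk1_one)
  fix \<phi> assume "\<phi> \<in> carrier ?G"
  then have \<phi>: "fg_essential_iso \<phi>" "max_ext \<phi> = \<phi>"
    by (auto simp: Gk1_carrier_iff max_ext_maximally_extended)
  have "Some \<circ>\<^sub>m \<phi> = \<phi>" by (auto simp: map_comp_def fun_eq_iff split: option.splits)
  then show "\<one>\<^bsub>?G\<^esub> \<otimes>\<^bsub>?G\<^esub> \<phi> = \<phi>" by (simp add: Gk1_mult Gk1_one \<phi>)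
  show "\<exists>\<psi>\<in>carrier ?G. \<psi> \<otimes>\<^bsub>?G\<^esub> \<phi> = \<one>\<^bsub>?G\<^esub>"
  proof
    let ?c = "converse_map \<phi>"
    have c: "fg_essential_iso ?c" by (rule fg_essential_iso_converse_map[OF \<phi>(1)])
    show "max_ext ?c \<in> carrier ?G" by (rule max_ext_in_Gk1[OF c])
    have "max_ext ?c \<otimes>\<^bsub>?G\<^esub> max_ext \<phi> = max_ext (?c \<circ>\<^sub>m \<phi>)"
      by (rule max_ext_mult_max_ext[OF c \<phi>(1)])
    also have "\<dots> = Some"
    proof (rule max_ext_restrict_id)
      show "essential_iso (?c \<circ>\<^sub>m \<phi>)" by (intro e fg_essential_iso_comp c \<phi>)
      \<comment> \<open>Before extension the composite is only a partial identity, defined on the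
        domain of \<open>\<phi>\<close>.\<close>
      show "?c \<circ>\<^sub>m \<phi> \<subseteq>\<^sub>m Some"
        using essential_isoD(3)[OF e[OF \<phi>(1)]]
        by (auto intro!: map_leI simp: map_comp_Some_iff converse_map_eq_Some[OF e[OF \<phi>(1)]])
    qed
    finally show "max_ext ?c \<otimes>\<^bsub>?G\<^esub> \<phi> = \<one>\<^bsub>?G\<^esub>" by (simp add: \<phi> Gk1_one)
  qed
  fix \<psi> \<chi> assume "\<psi> \<in> carrier ?G" "\<chi> \<in> carrier ?G"
  then have \<psi>: "fg_essential_iso \<psi>" "max_ext \<psi> = \<psi>" and \<chi>: "fg_essential_iso \<chi>" "max_ext \<chi> = \<chi>"
    by (auto simp: Gk1_carrier_iff max_ext_maximally_extended)
  have "(\<phi> \<circ>\<^sub>m \<psi>) \<circ>\<^sub>m \<chi> = \<phi> \<circ>\<^sub>m (\<psi> \<circ>\<^sub>m \<chi>)"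
    by (auto simp: map_comp_def fun_eq_iff split: option.splits)
  then have "max_ext (\<phi> \<circ>\<^sub>m \<psi>) \<otimes>\<^bsub>?G\<^esub> max_ext \<chi> = max_ext \<phi> \<otimes>\<^bsub>?G\<^esub> max_ext (\<psi> \<circ>\<^sub>m \<chi>)"
    using max_ext_mult_max_ext fg_essential_iso_comp \<phi> \<psi> \<chi> by metis
  then show "(\<phi> \<otimes>\<^bsub>?G\<^esub> \<psi>) \<otimes>\<^bsub>?G\<^esub> \<chi> = \<phi> \<otimes>\<^bsub>?G\<^esub> (\<psi> \<otimes>\<^bsub>?G\<^esub> \<chi>)" by (simp add: Gk1_mult \<phi> \<chi>)
qed

section \<open>Code cycles\<close>

definition word_list :: "nat \<Rightarrow> 'a::{finite,linorder} list list" where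
  "word_list n = sorted_list_of_set (words n)"

lemma set_word_list [simp]: "set (word_list n) = words n"
  and distinct_word_list [simp]: "distinct (word_list n)"
  and strict_sorted_word_list: "sorted_wrt (<) (word_list n)"
  by (simp_all add: word_list_def finite_words)

lemma length_word_list: "length (word_list n :: 'a::{finite,linorder} list list) = CARD('a) ^ n"
proof -
  have "card (words n :: 'a list set) = CARD('a) ^ n"
    using card_lists_length_eq[of "UNIV :: 'a set" n] by (simp add: words_def)
  then show ?thesis by (simp add: word_list_def)
qed

lemma word_list_nonempty [simp]: "word_list n \<noteq> []"
  using length_word_list[of n] by (metis list.size(3) power_not_zero zero_less_card_finite less_not_refl)

section \<open>Dictionary order and expansion to a common length\<close>

lemma less_append_mono:
  fixes x y :: "'a::linorder list"
  assumes "x < y" "\<not> prefix x y"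
  shows "x @ u < y @ v"
  using assms
proof (induction x arbitrary: y)
  case (Cons a x)
  then show ?case by (cases y) auto
qed simp

lemma append_less_append [simp]:
  fixes u v :: "'a::linorder list"
  shows "x @ u < x @ v \<longleftrightarrow> u < v"
  by (induction x) auto

text \<open>Each word becomes the sorted block of its extensions of length \<open>N\<close>. A word
  longer than \<open>N\<close> would become a singleton block, since the subtraction then yields
  \<open>word_list 0\<close>.\<close>

definition expand :: "nat \<Rightarrow> 'a::{finite,linorder} list list \<Rightarrow> 'a list list" where
  "expand N xs = concat (map (\<lambda>x. map ((@) x) (word_list (N - length x))) xs)"

lemma expand_simps [simp]:
  "expand N [] = []"
  "expand N (x # xs) = map ((@) x) (word_list (N - length x)) @ expand N xs"
  "expand N (xs @ ys) = expand N xs @ expand N ys"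
  by (simp_all add: expand_def)

lemma set_expand:
  assumes "\<And>x. x \<in> set xs \<Longrightarrow> length x \<le> N"
  shows "set (expand N xs) = {w \<in> words N. \<exists>x\<in>set xs. prefix x w}"
  using assms by (auto simp: expand_def words_def prefix_def)

text \<open>Distinct words of a prefix code differ at some letter, so their blocks do not
  interleave.\<close>

lemma strict_sorted_expand:
  assumes "sorted_wrt (<) xs" "prefix_code (set xs)"
  shows "sorted_wrt (<) (expand N xs)"
  using assms
proof (induction xs)
  case (Cons x xs)
  have "x @ u < y @ v" if "y \<in> set xs" for y u v
    using that Cons.prems by (intro less_append_mono) (auto simp: prefix_code_def)
  then have "\<forall>w\<in>set (map ((@) x) (word_list (N - length x))). \<forall>w'\<in>set (expand N xs). w < w'"
    by (auto simp: expand_def)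
  moreover have "sorted_wrt (<) (map ((@) x) (word_list (N - length x)))"
    by (simp add: sorted_wrt_map strict_sorted_word_list)
  ultimately show ?case using Cons by (simp add: sorted_wrt_append prefix_code_def)
qed simp

text \<open>Otherwise \<open>w\<close> could be added to the code: the length bound excludes that
  \<open>w\<close> is a proper prefix of a code word.\<close>

lemma max_prefix_code_covers:
  assumes "max_prefix_code P" "\<And>p. p \<in> P \<Longrightarrow> length p \<le> length w"
  shows "\<exists>p\<in>P. prefix p w"
proof (rule ccontr)
  assume *: "\<not> (\<exists>p\<in>P. prefix p w)"
  have "\<not> prefix w p" if "p \<in> P" for p
    using assms(2)[OF that] * that by (metis prefix_length_le prefix_order.refl prefix_order.antisym
        le_antisym not_equal_is_parallel parallelD1)
  then have "prefix_code (insert w P)"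
    using * assms(1) by (auto simp: max_prefix_code_def prefix_code_def)
  then have "insert w P = P" using assms(1) by (auto simp: max_prefix_code_def)
  then show False using * by auto
qed

lemma expand_max_prefix_code:
  assumes "max_prefix_code P" "finite P" "\<And>p. p \<in> P \<Longrightarrow> length p \<le> N"
  shows "expand N (sorted_list_of_set P) = word_list N"
proof (rule strict_sorted_equal)
  show "sorted_wrt (<) (word_list N)" by (rule strict_sorted_word_list)
  show "sorted_wrt (<) (expand N (sorted_list_of_set P))"
    using assms by (intro strict_sorted_expand) (auto simp: max_prefix_code_def)
  show "set (expand N (sorted_list_of_set P)) = set (word_list N)"
    using assms max_prefix_code_covers[OF assms(1)] by (subst set_expand) (auto simp: words_def)
qed

lemma prefix_code_words: "prefix_code (words n)"
  by (auto simp: prefix_code_def words_def prefix_def)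

lemma max_prefix_code_words: "max_prefix_code (words n)"
  unfolding max_prefix_code_def
proof (intro conjI allI impI prefix_code_words)
  fix Q :: "'a list set" assume Q: "prefix_code Q \<and> words n \<subseteq> Q"
  have "q \<in> words n" if q: "q \<in> Q" for q
  proof -
    \<comment> \<open>Padding makes this a word of length \<open>n\<close> comparable with
      \<open>q\<close>, whatever the length of \<open>q\<close>.\<close>
    define w where "w = take n (q @ replicate n undefined)"
    have "w \<in> words n" by (simp add: w_def words_def)
    moreover have "prefix w q \<or> prefix q w"
      unfolding w_def by (rule prefix_same_cases[OF take_is_prefix prefixI[OF refl]])
    ultimately show ?thesis using Q q unfolding prefix_code_def by (metis subsetD)
  qed
  then show "Q = words n" using Q by blast
qed

lemma expand_word_list: "n \<le> N \<Longrightarrow> expand N (word_list n) = word_list N"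
  unfolding word_list_def[of n]
  by (rule expand_max_prefix_code[OF max_prefix_code_words finite_words]) (simp add: words_def)

text \<open>Separate \<open>f\<close> and \<open>g\<close> allow the action on long words to be
  matched with an action given only on the entries of \<open>xs\<close>.\<close>

lemma expand_map:
  assumes "\<And>x u. x \<in> set xs \<Longrightarrow> length u = N - length x \<Longrightarrow> f (x @ u) = g x @ u"
    and "\<And>x. x \<in> set xs \<Longrightarrow> length (g x) = length x"
  shows "expand N (map g xs) = map f (expand N xs)"
  using assms
proof (induction xs)
  case (Cons x xs)
  have "map (f \<circ> (@) x) (word_list (N - length x)) = map ((@) (g x)) (word_list (N - length x))"
    using Cons.prems(1)[of x] by (auto simp: words_def)
  then show ?case using Cons by simp
qed simp

text \<open>Moving the first block to the end rotates the concatenation by the length of that block.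
  As the lengths may differ, the total amount stays implicit.\<close>

lemma concat_rotate: "\<exists>m'. concat (rotate m xss) = rotate m' (concat xss)"
proof (induction m)
  case 0
  show ?case by (rule exI[of _ 0]) simp
next
  case (Suc m)
  then obtain m' where m': "concat (rotate m xss) = rotate m' (concat xss)" by blast
  have "\<exists>l. concat (rotate1 yss) = rotate l (concat yss)" for yss :: "'a list list"
  proof (cases yss)
    case (Cons y ys)
    then have "concat (rotate1 yss) = rotate (length y) (concat yss)" by (simp add: rotate_append)
    then show ?thesis by blast
  qed auto
  then show ?case using m' by (metis rotate_Suc rotate_rotate)
qed

lemma expand_rotate: "\<exists>m'. expand N (rotate m xs) = rotate m' (expand N xs)"
  unfolding expand_def rotate_map[symmetric] by (rule concat_rotate)

text \<open>With blocks of equal length the amount is explicit, which later turns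
  \<open>tensor_id\<close> into a multiplication of residues.\<close>

lemma concat_rotate_uniform:
  assumes "\<And>xs. xs \<in> set xss \<Longrightarrow> length xs = l"
  shows "concat (rotate m xss) = rotate (m * l) (concat xss)"
proof (induction m)
  case (Suc m)
  have "concat (rotate1 yss) = rotate l (concat yss)" if "set yss = set xss" for yss
  proof (cases yss)
    case (Cons y ys)
    then have "length y = l" using that assms[of y] by auto
    then show ?thesis using Cons rotate_append[of y "concat ys"] by simp
  qed simp
  from this[of "rotate m xss"] Suc show ?case by (simp add: rotate_rotate add.commute)
qed simp

text \<open>The common first entry of the expansions extends the first word of either list, so these
  words are comparable and hence equal; their blocks then cancel.\<close>

lemma expand_inj:
  assumes "prefix_code P" "set xs \<subseteq> P" "set ys \<subseteq> P" "expand N xs = expand N ys"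
  shows "xs = ys"
  using assms(2-)
proof (induction xs arbitrary: ys)
  case Nil
  then show ?case by (cases ys) auto
next
  case (Cons x xs)
  then obtain y ys' where y: "ys = y # ys'" by (cases ys) auto
  have "hd (expand N (x # xs)) = x @ hd (word_list (N - length x))"
    "hd (expand N ys) = y @ hd (word_list (N - length y))" using y by (auto simp: hd_map)
  then have "x @ hd (word_list (N - length x)) = y @ hd (word_list (N - length y))"
    using Cons.prems by metis
  then have "prefix x y \<or> prefix y x" by (metis prefixI prefix_same_cases)
  then have "x = y" using assms(1) Cons.prems y unfolding prefix_code_def by auto
  then show ?case using Cons y by auto
qed

text \<open>In a distinct list the head of a rotation reveals the amount modulo the length.\<close>

lemma rotate_eq_if_hd_eq:
  assumes "distinct xs" "xs \<noteq> []" "hd (rotate i xs) = hd (rotate j xs)"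
  shows "rotate i xs = rotate j xs"
proof -
  have "i mod length xs = j mod length xs"
    using assms by (simp add: hd_rotate_conv_nth nth_eq_iff_index_eq)
  then show ?thesis by (metis rotate_conv_mod)
qed

text \<open>Being a cyclical order of a maximal prefix code can be tested after expanding all words to a
  common length \<open>N\<close>; on that level the cyclical orders are the rotations of one fixed list.\<close>

lemma is_code_cycle_iff:
  assumes len: "\<And>x. x \<in> set xs \<Longrightarrow> length x \<le> N"
  shows "is_code_cycle xs \<longleftrightarrow> (\<exists>j. expand N xs = rotate j (word_list N))"
proof
  assume "is_code_cycle xs"
  then obtain P m where P: "finite P" "max_prefix_code P" "xs = rotate m (sorted_list_of_set P)"
    unfolding is_code_cycle_def cyclical_order_def by blast
  then have "length p \<le> N" if "p \<in> P" for p using len that by auto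
  then show "\<exists>j. expand N xs = rotate j (word_list N)"
    using expand_max_prefix_code[OF P(2,1)] expand_rotate[of N m "sorted_list_of_set P"] P(3) by simp
next
  assume "\<exists>j. expand N xs = rotate j (word_list N)"
  then obtain j where j: "expand N xs = rotate j (word_list N)" by blast
  let ?P = "set xs"
  have dist: "distinct (expand N xs)" and set: "set (expand N xs) = words N" using j by auto
  have code: "prefix_code ?P"
    unfolding prefix_code_def
  proof (intro ballI impI)
    \<comment> \<open>Were \<open>x\<close> a proper prefix of \<open>y\<close>, the extension
      \<open>w\<close> of \<open>y\<close> would occur in both blocks, against the distinctness of
      the rotated listing.\<close>
    fix x y assume xy: "x \<in> ?P" "y \<in> ?P" "prefix x y"
    define w where "w = y @ hd (word_list (N - length y))"
    let ?B = "\<lambda>x. map ((@) x) (word_list (N - length x))"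
    have "hd (word_list (N - length y)) \<in> set (word_list (N - length y))" by (rule hd_in_set) simp
    then have l: "length (hd (word_list (N - length y)) :: 'a list) = N - length y"
      by (simp add: words_def)
    then have wy: "w \<in> set (?B y)" by (auto simp: w_def words_def)
    have wx: "w \<in> set (?B x)" using xy(3) l len[OF xy(1)] len[OF xy(2)]
      by (auto simp: w_def words_def prefix_def)
    show "x = y"
    proof (rule ccontr)
      assume "x \<noteq> y"
      have "\<exists>as bs cs. xs = as @ x # bs @ y # cs \<or> xs = as @ y # bs @ x # cs"
      proof -
        obtain as bs where as: "xs = as @ x # bs" using xy(1) by (meson split_list)
        with xy(2) \<open>x \<noteq> y\<close> consider "y \<in> set as" | "y \<in> set bs" by auto
        then show ?thesis
        proof cases
          case 1
          then obtain as1 as2 where "as = as1 @ y # as2" by (meson split_list)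
          then show ?thesis using as by (intro exI[of _ as1] exI[of _ as2] exI[of _ bs]) simp
        next
          case 2
          then obtain bs1 bs2 where "bs = bs1 @ y # bs2" by (meson split_list)
          then show ?thesis using as by (intro exI[of _ as] exI[of _ bs1] exI[of _ bs2]) simp
        qed
      qed
      then have "set (?B x) \<inter> set (?B y) = {}" using dist by (elim exE disjE) auto
      then show False using wx wy by blast
    qed
  qed
  have "max_prefix_code ?P"
    unfolding max_prefix_code_def
  proof (intro conjI allI impI code)
    fix Q assume Q: "prefix_code Q \<and> ?P \<subseteq> Q"
    have "q \<in> ?P" if q: "q \<in> Q" for q
    proof -
      \<comment> \<open>The first \<open>N\<close> letters of the padded \<open>q\<close> are
        covered by some \<open>p\<close> in \<open>?P\<close>. Both \<open>p\<close> and
        \<open>q\<close> are prefixes of the padded word, hence comparable.\<close>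
      define w where "w = take N (q @ replicate N undefined)"
      have "w \<in> words N" by (simp add: w_def words_def)
      then obtain p where p: "p \<in> ?P" "prefix p w" using set set_expand[OF len] by blast
      have "prefix w (q @ replicate N undefined)" unfolding w_def by (rule take_is_prefix)
      then have "prefix p q \<or> prefix q p"
        using p(2) by (meson prefixI prefix_order.trans prefix_same_cases)
      then show ?thesis using Q q p unfolding prefix_code_def by (metis subsetD)
    qed
    then show "Q = ?P" using Q by blast
  qed
  \<comment> \<open>The first word fixes the offset: rotate the sorted code until it starts like
    \<open>xs\<close>. Both expansions are then rotations of \<open>word_list N\<close> with the
    same head, hence equal, and expansion is injective over a code.\<close>
  define ys where "ys = sorted_list_of_set ?P"
  have ys: "expand N ys = word_list N" "set ys = ?P"
    unfolding ys_def using expand_max_prefix_code[OF \<open>max_prefix_code ?P\<close>] len by auto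
  have "xs \<noteq> []" using j by (auto dest: sym)
  then obtain x xs' where x: "xs = x # xs'" by (cases xs) auto
  then obtain as bs where "ys = as @ x # bs" using ys(2) by (metis list.set_intros(1) split_list)
  then have zs: "rotate (length as) ys = x # bs @ as" using rotate_append[of as "x # bs"] by simp
  obtain i where i: "expand N (rotate (length as) ys) = rotate i (word_list N)"
    using expand_rotate[of N "length as" ys] ys(1) by auto
  have "rotate i (word_list N :: 'a list list) = rotate j (word_list N)"
  proof (rule rotate_eq_if_hd_eq)
    show "hd (rotate i (word_list N)) = hd (rotate j (word_list N) :: 'a list list)"
      unfolding i[symmetric] j[symmetric] zs unfolding x by simp
  qed auto
  then have "xs = rotate (length as) ys"
    using expand_inj[OF code, of xs "rotate (length as) ys" N] i j ys(2) by simp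
  then show "is_code_cycle xs"
    using \<open>max_prefix_code ?P\<close> unfolding is_code_cycle_def cyclical_order_def ys_def by blast
qed

section \<open>The cyclic groups of rotations\<close>

text \<open>The word at index \<open>i\<close> goes to index \<open>i + m\<close> modulo the number
  of words. Using \<open>rotate\<close> makes the image of the listing literally a rotated list; the
  restriction makes the function extensional, as \<open>BijGroup\<close> demands.\<close>

definition word_rotation :: "nat \<Rightarrow> nat \<Rightarrow> 'a::{finite,linorder} list \<Rightarrow> 'a list" where
  "word_rotation n m = (\<lambda>w\<in>words n.
     rotate m (word_list n) ! inv_into {..<CARD('a) ^ n} ((!) (word_list n)) w)"

lemma map_word_rotation:
  "map (word_rotation n m) (word_list n :: 'a::{finite,linorder} list list) = rotate m (word_list n)"
proof (rule nth_equalityI)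
  let ?W = "word_list n :: 'a list list"
  fix i assume "i < length (map (word_rotation n m) ?W)"
  then have i: "i < CARD('a) ^ n" by (simp add: length_word_list)
  have "inj_on ((!) ?W) {..<CARD('a) ^ n}"
    by (simp add: inj_on_nth length_word_list)
  then have "inv_into {..<CARD('a) ^ n} ((!) ?W) (?W ! i) = i" using i by simp
  moreover have "?W ! i \<in> words n"
    using i length_word_list[of n] by (metis nth_mem set_word_list)
  ultimately show "map (word_rotation n m) ?W ! i = rotate m ?W ! i"
    using i by (simp add: word_rotation_def length_word_list)
qed simp

lemma extensional_words_eqI:
  assumes "f \<in> extensional (words n)" "g \<in> extensional (words n)"
    and "map f (word_list n) = map g (word_list n)"
  shows "f = g"
  using assms by (intro extensionalityI) (auto simp: map_eq_conv)

lemma word_rotation_extensional [simp]: "word_rotation n m \<in> extensional (words n)"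
  by (simp add: word_rotation_def)

lemma word_rotation_unique:
  assumes "f \<in> extensional (words n)" "map f (word_list n) = rotate m (word_list n)"
  shows "f = word_rotation n m"
  by (rule extensional_words_eqI[OF assms(1) word_rotation_extensional
        trans[OF assms(2) map_word_rotation[symmetric]]])

lemma word_rotation_Bij: "word_rotation n m \<in> Bij (words n)"
proof -
  have "distinct (map (word_rotation n m) (word_list n))"
    "set (map (word_rotation n m) (word_list n)) = words n"
    by (simp_all only: map_word_rotation distinct_rotate set_rotate distinct_word_list set_word_list)
  then show ?thesis by (simp add: Bij_def bij_betw_def distinct_map)
qed

lemma word_rotation_eq_iff:
  "(word_rotation n m :: 'a::{finite,linorder} list \<Rightarrow> 'a list) = word_rotation n m' \<longleftrightarrow>
   m mod CARD('a) ^ n = m' mod CARD('a) ^ n" (is "?f = ?g \<longleftrightarrow> _")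
proof
  assume "?f = ?g"
  then have "hd (rotate m (word_list n :: 'a list list)) = hd (rotate m' (word_list n))"
    using map_word_rotation by metis
  then show "m mod CARD('a) ^ n = m' mod CARD('a) ^ n"
    by (simp add: hd_rotate_conv_nth nth_eq_iff_index_eq length_word_list)
next
  assume "m mod CARD('a) ^ n = m' mod CARD('a) ^ n"
  then have "rotate m (word_list n :: 'a list list) = rotate m' (word_list n)"
    using rotate_conv_mod length_word_list by metis
  then show "?f = ?g" using map_word_rotation word_rotation_extensional word_rotation_unique by metis
qed

lemma compose_word_rotation:
  "compose (words n) (word_rotation n m) (word_rotation n m') = word_rotation n (m + m')"
proof (rule word_rotation_unique)
  have "map (compose (words n) (word_rotation n m) (word_rotation n m')) (word_list n) =
    map (word_rotation n m) (map (word_rotation n m') (word_list n))"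
    by (simp add: compose_def)
  also have "\<dots> = rotate (m + m') (word_list n)"
    by (simp only: map_word_rotation rotate_map[symmetric] rotate_rotate add.commute)
  finally show "map (compose (words n) (word_rotation n m) (word_rotation n m')) (word_list n) =
    rotate (m + m') (word_list n)" .
qed (simp add: compose_def)

lemma word_shift_eq: "word_shift n = (word_rotation n 1 :: 'a::{finite,linorder} list \<Rightarrow> 'a list)"
proof
  fix w :: "'a list"
  let ?W = "word_list n :: 'a list list" and ?N = "CARD('a) ^ n"
  show "word_shift n w = word_rotation n 1 w"
  proof (cases "w \<in> words n")
    case True
    then have "w \<in> set ?W" by simp
    then obtain i where "i < ?N" "w = ?W ! i" unfolding in_set_conv_nth length_word_list by blast
    then have "w \<in> (!) ?W ` {..<?N}" by blast
    then have "inv_into {..<?N} ((!) ?W) w \<in> {..<?N}" by (rule inv_into_into)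
    then have "rotate1 ?W ! inv_into {..<?N} ((!) ?W) w = ?W ! ((inv_into {..<?N} ((!) ?W) w + 1) mod ?N)"
      by (subst nth_rotate1) (simp_all add: length_word_list)
    moreover have "word_shift n w = ?W ! ((inv_into {..<?N} ((!) ?W) w + 1) mod ?N)"
      unfolding word_shift_def word_list_def[symmetric] Let_def using True by (rule restrict_apply')
    moreover have "word_rotation n 1 w = rotate 1 ?W ! inv_into {..<?N} ((!) ?W) w"
      unfolding word_rotation_def using True by (rule restrict_apply')
    ultimately show ?thesis by simp
  next
    case False
    then show ?thesis
      unfolding word_shift_def word_rotation_def Let_def restrict_def by (simp only: if_False)
  qed
qed

lemma group_ZA: "group (ZA n)"
  unfolding ZA_def by (rule group.group_subgroup_generated[OF group_BijGroup])

lemma ZA_one: "\<one>\<^bsub>ZA n\<^esub> = word_rotation n 0"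
proof -
  have "(\<lambda>x\<in>words n. x) = (word_rotation n 0 :: 'a list \<Rightarrow> 'a list)"
  proof (rule word_rotation_unique)
    show "map (\<lambda>x\<in>words n. x) (word_list n) = rotate 0 (word_list n :: 'a list list)"
      unfolding rotate0 id_apply by (rule map_idI) simp
  qed simp
  then show ?thesis by (simp add: ZA_def BijGroup_def)
qed

lemma BijGroup_mult_word_rotation:
  "word_rotation n m \<otimes>\<^bsub>BijGroup (words n)\<^esub> word_rotation n m' = word_rotation n (m + m')"
  by (simp add: BijGroup_def word_rotation_Bij compose_word_rotation)

lemma ZA_mult:
  "word_rotation n m \<otimes>\<^bsub>ZA n\<^esub> word_rotation n m' = word_rotation n (m + m')"
  by (simp add: ZA_def BijGroup_mult_word_rotation)

text \<open>The rotations form a subgroup containing the generator, and each is a power of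
  it.\<close>

lemma carrier_ZA: "carrier (ZA n) = range (word_rotation n)"
proof -
  let ?G = "BijGroup (words n) :: ('a list \<Rightarrow> 'a list) monoid"
  let ?r = "word_rotation n :: nat \<Rightarrow> 'a list \<Rightarrow> 'a list"
  interpret group ?G by (rule group_BijGroup)
  have c: "?r m \<in> carrier ?G" for m by (simp add: BijGroup_def word_rotation_Bij)
  have one: "\<one>\<^bsub>?G\<^esub> = ?r 0" using ZA_one by (simp add: ZA_def)
  have pow: "?r 1 [^]\<^bsub>?G\<^esub> m = ?r m" for m :: nat
  proof (induction m)
    case (Suc m)
    then show ?case unfolding nat_pow_Suc by (simp only: BijGroup_mult_word_rotation Suc_eq_plus1)
  qed (simp add: one)
  have "subgroup (range ?r) ?G"
  proof (rule subgroupI)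
    show "inv\<^bsub>?G\<^esub> f \<in> range ?r" if "f \<in> range ?r" for f
    proof -
      obtain m where m: "f = ?r m" using \<open>f \<in> range ?r\<close> by blast
      \<comment> \<open>The residue of \<open>-m\<close> as a natural number; nothing is truncated
        because \<open>CARD('a) ^ n\<close> is at least one.\<close>
      define l where "l = m * CARD('a) ^ n - m"
      have "m * 1 \<le> m * CARD('a) ^ n" by (rule mult_le_mono2) (simp add: Suc_le_eq)
      then have "l + m = m * CARD('a) ^ n" by (simp add: l_def)
      then have "?r l \<otimes>\<^bsub>?G\<^esub> ?r m = \<one>\<^bsub>?G\<^esub>"
        unfolding BijGroup_mult_word_rotation one word_rotation_eq_iff by simp
      then have "inv\<^bsub>?G\<^esub> (?r m) = ?r l" by (rule inv_equality[OF _ c c])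
      then show ?thesis using m by simp
    qed
    show "f \<otimes>\<^bsub>?G\<^esub> g \<in> range ?r" if "f \<in> range ?r" "g \<in> range ?r" for f g
      using that BijGroup_mult_word_rotation by fast
    show "range ?r \<subseteq> carrier ?G" using c by blast
  qed simp
  then have "carrier (ZA n) \<subseteq> range ?r"
    unfolding ZA_def word_shift_eq by (rule subgroup_generated_minimal) blast
  moreover have "?r m \<in> carrier (ZA n)" for m
  proof -
    interpret Z: group "ZA n :: ('a list \<Rightarrow> 'a list) monoid" by (rule group_ZA)
    have "?r 1 \<in> carrier (ZA n)"
      unfolding ZA_def word_shift_eq carrier_subgroup_generated 
      by (rule generate.incl) (simp add: c del: One_nat_def)
    then have "?r 1 [^]\<^bsub>ZA n\<^esub> m \<in> carrier (ZA n)" by (rule Z.nat_pow_closed)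
    then show ?thesis unfolding ZA_def pow_subgroup_generated pow .
  qed
  ultimately show ?thesis by blast
qed

text \<open>Each word of length \<open>n\<close> carries a block of \<open>CARD('a)\<close>
  consecutive words of length \<open>n + 1\<close>, and \<open>tensor_id\<close> moves whole
  blocks.\<close>

lemma tensor_id_word_rotation:
  "tensor_id n (word_rotation n m :: 'a::{finite,linorder} list \<Rightarrow> 'a list) =
   word_rotation (Suc n) (m * CARD('a))"
proof (rule word_rotation_unique)
  let ?r = "word_rotation n m :: 'a list \<Rightarrow> 'a list"
  show "tensor_id n ?r \<in> extensional (words (Suc n))" by (simp add: tensor_id_def)
  have "map (tensor_id n ?r) (word_list (Suc n)) = map (tensor_id n ?r) (expand (Suc n) (word_list n))"
    by (simp add: expand_word_list)
  also have "\<dots> = expand (Suc n) (map ?r (word_list n))"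
  proof (rule expand_map[symmetric])
    fix x :: "'a list" assume "x \<in> set (word_list n)"
    then have x: "x \<in> words n" by simp
    then show "length (?r x) = length x"
      using word_rotation_Bij[of n m] by (auto simp: Bij_def bij_betw_def words_def)
    have n: "length x = n" using x by (simp add: words_def)
    fix u :: "'a list" assume "length u = Suc n - length x"
    then have "length u = Suc 0" by (simp add: n)
    then obtain a where "u = [a]" unfolding length_Suc_conv by auto
    then show "tensor_id n ?r (x @ u) = ?r x @ u" using n by (simp add: tensor_id_def words_def)
  qed
  also have "\<dots> = expand (Suc n) (rotate m (word_list n))" by (simp only: map_word_rotation)
  also have "\<dots> = rotate (m * CARD('a)) (expand (Suc n) (word_list n))"
    unfolding expand_def rotate_map[symmetric]
  proof (rule concat_rotate_uniform)
    fix ws assume "ws \<in> set (map (\<lambda>x. map ((@) x) (word_list (Suc n - length x))) (word_list n :: 'a list list))"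
    then obtain x :: "'a list" where "length x = n" "ws = map ((@) x) (word_list (Suc n - length x))"
      unfolding set_map set_word_list words_def by blast
    then show "length ws = CARD('a)" by (simp add: length_word_list)
  qed
  finally show "map (tensor_id n ?r) (word_list (Suc n)) = rotate (m * CARD('a)) (word_list (Suc n))"
    by (simp add: expand_word_list)
qed

text \<open>On residues this is multiplication by \<open>k = CARD('a)\<close>, which is additive,
  and injective from residues modulo \<open>k^n\<close> to residues modulo
  \<open>k^(n+1)\<close>.\<close>

lemma tensor_id_mon: "tensor_id n \<in> mon (ZA n :: ('a::{finite,linorder} list \<Rightarrow> 'a list) monoid) (ZA (Suc n))"
proof -
  let ?r = "\<lambda>n. word_rotation n :: nat \<Rightarrow> 'a list \<Rightarrow> 'a list"
  have "?r n m = ?r n m'" if "tensor_id n (?r n m) = tensor_id n (?r n m')" for m m'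
  proof -
    have "(CARD('a) * m) mod (CARD('a) * CARD('a) ^ n) = (CARD('a) * m') mod (CARD('a) * CARD('a) ^ n)"
      using that unfolding tensor_id_word_rotation word_rotation_eq_iff by (simp add: mult.commute)
    then show ?thesis unfolding word_rotation_eq_iff mult_mod_right[symmetric] by simp
  qed
  moreover have "tensor_id n (?r n m \<otimes>\<^bsub>ZA n\<^esub> ?r n m') =
      tensor_id n (?r n m) \<otimes>\<^bsub>ZA (Suc n)\<^esub> tensor_id n (?r n m')" for m m'
    by (simp only: ZA_mult tensor_id_word_rotation distrib_right)
  moreover have "tensor_id n (?r n m) \<in> range (?r (Suc n))" for m
    by (simp only: tensor_id_word_rotation rangeI)
  ultimately show ?thesis unfolding mon_def hom_def carrier_ZA inj_on_def by blast
qed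

section \<open>Direct limits of compatible embeddings\<close>

text \<open>Injective maps into one group \<open>H\<close> let elements of different levels be
  compared inside \<open>H\<close>, so classes of the limit become fibres. The locale serves for
  both \<open>Gk1\<close> and the Pruefer group.\<close>

locale direct_limit_cocone =
  fixes G :: "nat \<Rightarrow> 'b monoid" and f :: "nat \<Rightarrow> 'b \<Rightarrow> 'b"
    and H :: "('c, 'd) monoid_scheme" and R :: "nat \<Rightarrow> 'b \<Rightarrow> 'c"
  assumes group_G: "group (G n)" and group_H: "group H"
    and f_hom: "f n \<in> hom (G n) (G (Suc n))" and R_hom: "R n \<in> hom (G n) H"
    and R_inj: "inj_on (R n) (carrier (G n))"
    and compat: "x \<in> carrier (G n) \<Longrightarrow> R (Suc n) (f n x) = R n x"
begin

lemma transition_closed: "m \<le> n \<Longrightarrow> x \<in> carrier (G m) \<Longrightarrow> transition f m n x \<in> carrier (G n)"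
  and R_transition: "m \<le> n \<Longrightarrow> x \<in> carrier (G m) \<Longrightarrow> R n (transition f m n x) = R m x"
proof -
  have "transition f m n x \<in> carrier (G n) \<and> R n (transition f m n x) = R m x"
    if "m \<le> n" "x \<in> carrier (G m)" using that
  proof (induction n rule: dec_induct)
    case base
    then show ?case by (simp add: transition_def)
  next
    case (step n)
    then have "transition f m (Suc n) x = f n (transition f m n x)"
      by (simp add: transition_def)
    then show ?case using step compat[of "transition f m n x" n] hom_in_carrier[OF f_hom] by auto
  qed
  then show "m \<le> n \<Longrightarrow> x \<in> carrier (G m) \<Longrightarrow> transition f m n x \<in> carrier (G n)"
    "m \<le> n \<Longrightarrow> x \<in> carrier (G m) \<Longrightarrow> R n (transition f m n x) = R m x" by auto
qed

text \<open>Transitions preserve the image in \<open>H\<close>, and injectivity of \<open>R\<close>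
  at level \<open>max m n\<close> makes equal images equal there, so the search for a level
  disappears.\<close>

lemma dirlim_rel_iff:
  "((m, x), (n, y)) \<in> dirlim_rel G f \<longleftrightarrow> x \<in> carrier (G m) \<and> y \<in> carrier (G n) \<and> R m x = R n y"
proof -
  have "(\<exists>l. m \<le> l \<and> n \<le> l \<and> transition f m l x = transition f n l y) \<longleftrightarrow> R m x = R n y"
    if xy: "x \<in> carrier (G m)" "y \<in> carrier (G n)"
  proof
    assume "\<exists>l. m \<le> l \<and> n \<le> l \<and> transition f m l x = transition f n l y"
    then obtain l where "m \<le> l" "n \<le> l" "transition f m l x = transition f n l y" by blast
    then show "R m x = R n y" using R_transition[of m l x] R_transition[of n l y] xy by simp
  next
    assume eq: "R m x = R n y"
    have "transition f m (max m n) x = transition f n (max m n) y"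
      using xy eq by (intro inj_onD[OF R_inj[of "max m n"]]) (simp_all add: R_transition transition_closed)
    then show "\<exists>l. m \<le> l \<and> n \<le> l \<and> transition f m l x = transition f n l y"
      by (intro exI[of _ "max m n"]) simp
  qed
  then show ?thesis by (auto simp: dirlim_rel_def)
qed

text \<open>The limit class corresponding to \<open>h\<close>; empty when \<open>h\<close> lies in
  no image.\<close>

definition fibre :: "'c \<Rightarrow> (nat \<times> 'b) set" where
  "fibre h = {(n, x). x \<in> carrier (G n) \<and> R n x = h}"

lemma dirlim_in_eq_fibre: "x \<in> carrier (G n) \<Longrightarrow> dirlim_in G f n x = fibre (R n x)"
  by (auto simp: dirlim_in_def fibre_def dirlim_rel_iff)

definition image_carrier :: "'c set" where
  "image_carrier = (\<Union>n. R n ` carrier (G n))"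

lemma common_level:
  assumes "g \<in> image_carrier" "h \<in> image_carrier"
  obtains n x y where "x \<in> carrier (G n)" "y \<in> carrier (G n)" "R n x = g" "R n y = h"
proof -
  obtain m x n y where "x \<in> carrier (G m)" "R m x = g" "y \<in> carrier (G n)" "R n y = h"
    using assms by (auto simp: image_carrier_def)
  then show ?thesis
    using that[of "transition f m (max m n) x" "max m n" "transition f n (max m n) y"]
    by (simp add: transition_closed R_transition)
qed

text \<open>The union is closed under products because two elements can be pushed to one
  level.\<close>

lemma subgroup_image_carrier: "subgroup image_carrier H"
proof -
  interpret H: group H by (rule group_H)
  show ?thesis
  proof (rule H.subgroupI)
    show "image_carrier \<subseteq> carrier H"
      using hom_in_carrier[OF R_hom] by (auto simp: image_carrier_def)
    have "R 0 \<one>\<^bsub>G 0\<^esub> \<in> image_carrier"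
      using group.is_monoid[OF group_G] monoid.one_closed by (force simp: image_carrier_def)
    then show "image_carrier \<noteq> {}" by blast
  next
    fix g assume "g \<in> image_carrier"
    then obtain n x where x: "x \<in> carrier (G n)" "g = R n x" by (auto simp: image_carrier_def)
    interpret group_hom "G n" H "R n"
      using group_G group_H R_hom by (simp add: group_hom_def group_hom_axioms_def)
    have "inv\<^bsub>H\<^esub> g = R n (inv\<^bsub>G n\<^esub> x)" "inv\<^bsub>G n\<^esub> x \<in> carrier (G n)" using x by simp_all
    then show "inv\<^bsub>H\<^esub> g \<in> image_carrier" unfolding image_carrier_def by blast
  next
    fix g h assume "g \<in> image_carrier" "h \<in> image_carrier"
    then obtain n x y where xy: "x \<in> carrier (G n)" "y \<in> carrier (G n)" "R n x = g" "R n y = h"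
      by (rule common_level)
    then have "g \<otimes>\<^bsub>H\<^esub> h = R n (x \<otimes>\<^bsub>G n\<^esub> y)" using hom_mult[OF R_hom] by metis
    moreover have "x \<otimes>\<^bsub>G n\<^esub> y \<in> carrier (G n)"
      using xy group.is_monoid[OF group_G] monoid.m_closed by metis
    ultimately show "g \<otimes>\<^bsub>H\<^esub> h \<in> image_carrier" by (auto simp: image_carrier_def)
  qed
qed

text \<open>The product of two classes is a union over all pairs of representatives, and every pair
  contributes the same fibre.\<close>

lemma fibre_mult:
  assumes "g \<in> image_carrier" "h \<in> image_carrier"
  shows "fibre g \<otimes>\<^bsub>direct_limit G f\<^esub> fibre h = fibre (g \<otimes>\<^bsub>H\<^esub> h)"
proof -
  have *: "dirlim_in G f (max m n)
      (transition f m (max m n) x \<otimes>\<^bsub>G (max m n)\<^esub> transition f n (max m n) y) = fibre (g \<otimes>\<^bsub>H\<^esub> h)"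
    if "(m, x) \<in> fibre g" "(n, y) \<in> fibre h" for m x n y
  proof -
    let ?l = "max m n"
    have x: "transition f m ?l x \<in> carrier (G ?l)" "R ?l (transition f m ?l x) = g"
      and y: "transition f n ?l y \<in> carrier (G ?l)" "R ?l (transition f n ?l y) = h"
      using that by (simp_all add: fibre_def transition_closed R_transition)
    have "transition f m ?l x \<otimes>\<^bsub>G ?l\<^esub> transition f n ?l y \<in> carrier (G ?l)"
      using x y group.is_monoid[OF group_G] monoid.m_closed by metis
    then show ?thesis
      using hom_mult[OF R_hom x(1) y(1)] x(2) y(2) by (simp add: dirlim_in_eq_fibre)
  qed
  \<comment> \<open>Without representatives the union would be empty instead of the fibre.\<close>
  have "fibre g \<noteq> {}" "fibre h \<noteq> {}" using assms by (auto simp: fibre_def image_carrier_def)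
  let ?P = "\<lambda>(m, x) (n, y). dirlim_in G f (max m n)
      (transition f m (max m n) x \<otimes>\<^bsub>G (max m n)\<^esub> transition f n (max m n) y)"
  have "fibre g \<otimes>\<^bsub>direct_limit G f\<^esub> fibre h = (\<Union>p\<in>fibre g. \<Union>q\<in>fibre h. ?P p q)"
    by (simp add: direct_limit_def split_def)
  also have "\<dots> = (\<Union>p\<in>fibre g. \<Union>q\<in>fibre h. fibre (g \<otimes>\<^bsub>H\<^esub> h))"
    by (intro SUP_cong refl) (use * in \<open>force simp: split_def\<close>)
  also have "\<dots> = fibre (g \<otimes>\<^bsub>H\<^esub> h)" using \<open>fibre g \<noteq> {}\<close> \<open>fibre h \<noteq> {}\<close> by simp
  finally show ?thesis .
qed

text \<open>This direction is explicit, whereas a map out of the limit would call for a choice of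
  representatives.\<close>

lemma fibre_iso: "fibre \<in> iso (H\<lparr>carrier := image_carrier\<rparr>) (direct_limit G f)"
proof -
  have quot: "carrier (direct_limit G f) = fibre ` image_carrier"
  proof -
    have "carrier (direct_limit G f) = (\<Union>n. \<Union>x\<in>carrier (G n). {dirlim_in G f n x})"
      by (auto simp: direct_limit_def quotient_def dirlim_in_def)
    then show ?thesis by (auto simp: dirlim_in_eq_fibre image_carrier_def)
  qed
  have "inj_on fibre image_carrier"
  proof (rule inj_onI)
    fix g h assume "g \<in> image_carrier" and eq: "fibre g = fibre h"
    then obtain n x where "(n, x) \<in> fibre g" by (auto simp: fibre_def image_carrier_def)
    moreover from this have "(n, x) \<in> fibre h" using eq by simp
    ultimately show "g = h" by (simp add: fibre_def)
  qed
  then show ?thesis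
    by (auto simp: iso_def hom_def bij_betw_def quot fibre_mult)
qed

lemma direct_limit_iso:
  "\<exists>\<Phi>\<in>iso (direct_limit G f) (H\<lparr>carrier := image_carrier\<rparr>).
     \<forall>n. \<forall>x\<in>carrier (G n). \<Phi> (dirlim_in G f n x) = R n x"
proof (intro bexI allI ballI)
  let ?K = "H\<lparr>carrier := image_carrier\<rparr>"
  have K: "group ?K"
    using subgroup.subgroup_is_group[OF subgroup_image_carrier group_H] .
  show "inv_into (carrier ?K) fibre \<in> iso (direct_limit G f) ?K"
    by (rule group.iso_set_sym[OF K fibre_iso])
  fix n x assume x: "x \<in> carrier (G n)"
  have "inj_on fibre (carrier ?K)" using fibre_iso by (simp add: iso_def bij_betw_def)
  moreover have "R n x \<in> carrier ?K" using x by (auto simp: image_carrier_def)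
  ultimately show "inv_into (carrier ?K) fibre (dirlim_in G f n x) = R n x"
    using x by (simp add: dirlim_in_eq_fibre inv_into_f_f)
qed

end

section \<open>Rotations as elements of \<open>G_{k,1}\<close>\<close>

lemma ideal_gen_words: "ideal_gen (words n) = {w. n \<le> length w}"
proof -
  have "\<exists>p z. w = p @ z \<and> p \<in> words n" if "n \<le> length w" for w :: "'a list"
    using that by (intro exI[of _ "take n w"] exI[of _ "drop n w"]) (simp add: words_def)
  then show ?thesis unfolding ideal_gen_def by (auto simp: words_def)
qed

lemma ideal_ext_words:
  "ideal_ext (words n) f w = (if n \<le> length w then Some (f (take n w) @ drop n w) else None)"
proof -
  have "(THE p. p \<in> words n \<and> prefix p w) = take n w" if "n \<le> length w"
  proof (rule the_equality)
    show "take n w \<in> words n \<and> prefix (take n w) w" using that by (simp add: words_def take_is_prefix)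
  qed (auto simp: words_def prefix_def)
  then show ?thesis by (auto simp: ideal_ext_def ideal_gen_words Let_def)
qed

lemma fg_essential_iso_ideal_ext:
  fixes \<pi> :: "'a::finite list \<Rightarrow> 'a list"
  assumes "bij_betw \<pi> (words n) (words n)"
  shows "fg_essential_iso (ideal_ext (words n) \<pi>)"
proof (rule fg_essential_isoI)
  have im: "\<pi> ` words n = words n" and inj: "inj_on \<pi> (words n)"
    using assms by (auto simp: bij_betw_def)
  have l: "length (\<pi> v) = n" if "length v = n" for v using im that by (auto simp: words_def)
  show "w \<in> dom (ideal_ext (words n) \<pi>)" if "n \<le> length w" for w
    using that by (simp add: dom_def ideal_ext_words)
  show "w \<in> ran (ideal_ext (words n) \<pi>)" if "n \<le> length w" for w
  proof -
    have "take n w \<in> \<pi> ` words n" using that im by (simp add: words_def)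
    then obtain v where "length v = n" "\<pi> v = take n w" by (auto simp: words_def)
    then have "ideal_ext (words n) \<pi> (v @ drop n w) = Some w" by (simp add: ideal_ext_words)
    then show ?thesis by (rule ranI)
  qed
  show "ideal_ext (words n) \<pi> (x @ z) = Some (y @ z)" if "ideal_ext (words n) \<pi> x = Some y" for x y z
    using that by (auto simp: ideal_ext_words split: if_splits)
  fix x x' y
  assume y: "ideal_ext (words n) \<pi> x = Some y" "ideal_ext (words n) \<pi> x' = Some y"
  then have n: "n \<le> length x" "n \<le> length x'"
    and "\<pi> (take n x) @ drop n x = \<pi> (take n x') @ drop n x'"
    by (auto simp: ideal_ext_words split: if_splits)
  \<comment> \<open>Both \<open>\<pi>\<close>-images have length \<open>n\<close>, so the equation
    splits at that position.\<close>
  then have *: "\<pi> (take n x) = \<pi> (take n x')" "drop n x = drop n x'"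
    using l[of "take n x"] l[of "take n x'"] by auto
  have "take n x = take n x'" by (rule inj_onD[OF inj *(1)]) (use n in \<open>auto simp: words_def\<close>)
  then show "x = x'" using *(2) by (metis append_take_drop_id)
qed

lemma ideal_ext_comp:
  assumes "\<rho> ` words n \<subseteq> words n"
  shows "ideal_ext (words n) \<pi> \<circ>\<^sub>m ideal_ext (words n) \<rho> = ideal_ext (words n) (compose (words n) \<pi> \<rho>)"
proof
  fix w
  have "length (\<rho> (take n w)) = n" if "n \<le> length w"
    using assms that by (auto simp: words_def image_subset_iff)
  then show "(ideal_ext (words n) \<pi> \<circ>\<^sub>m ideal_ext (words n) \<rho>) w =
      ideal_ext (words n) (compose (words n) \<pi> \<rho>) w"
    by (simp add: map_comp_def ideal_ext_words compose_def in_words_iff)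
qed

text \<open>The letter at index \<open>n\<close> moves from the untouched remainder into the code
  word without changing the value. The equation holds before maximal extension, so the embedding is
  literally a restriction.\<close>

lemma ideal_ext_tensor_id:
  "ideal_ext (words (Suc n)) (tensor_id n \<pi>) = ideal_ext (words n) \<pi> |` ideal_gen (words (Suc n))"
proof
  fix w :: "'a list"
  show "ideal_ext (words (Suc n)) (tensor_id n \<pi>) w =
      (ideal_ext (words n) \<pi> |` ideal_gen (words (Suc n))) w"
  proof (cases "Suc n \<le> length w")
    case True
    then have "take (Suc n) w = take n w @ [w ! n]" by (simp add: take_Suc_conv_app_nth)
    moreover have "drop n w = w ! n # drop (Suc n) w" using True by (simp add: Cons_nth_drop_Suc)
    ultimately show ?thesis
      using True by (simp add: ideal_ext_words ideal_gen_words restrict_map_def tensor_id_def in_words_iff)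
  qed (simp add: ideal_ext_words ideal_gen_words restrict_map_def)
qed

lemma ZA_imp_Bij: "\<pi> \<in> carrier (ZA n) \<Longrightarrow> \<pi> \<in> Bij (words n)"
  using word_rotation_Bij by (auto simp: carrier_ZA)

lemma length_ZA_apply: "\<pi> \<in> carrier (ZA n) \<Longrightarrow> length w = n \<Longrightarrow> length (\<pi> w) = n"
  using Bij_imp_funcset[OF ZA_imp_Bij, of \<pi> n] by (auto simp: in_words_iff)

lemma fg_essential_iso_ideal_ext_ZA:
  "\<pi> \<in> carrier (ZA n) \<Longrightarrow> fg_essential_iso (ideal_ext (words n) \<pi>)"
  using fg_essential_iso_ideal_ext[of \<pi> n] ZA_imp_Bij[of \<pi> n] by (simp add: Bij_def)

text \<open>The cocone condition for \<open>Gk1\<close>: a restriction has the same maximal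
  extension.\<close>

lemma represented_tensor_id:
  assumes "\<pi> \<in> carrier (ZA n)"
  shows "represented (words (Suc n)) (tensor_id n \<pi>) = represented (words n) \<pi>"
  unfolding represented_def
proof (rule max_ext_cong)
  have "tensor_id n \<pi> \<in> carrier (ZA (Suc n))"
    using hom_in_carrier[of "tensor_id n"] assms tensor_id_mon unfolding mon_def by blast
  then show "essential_iso (ideal_ext (words (Suc n)) (tensor_id n \<pi>))"
    using fg_essential_iso_ideal_ext_ZA fg_essential_iso_iff by blast
  show "essential_iso (ideal_ext (words n) \<pi>)"
    using assms fg_essential_iso_ideal_ext_ZA fg_essential_iso_iff by blast
  show "ideal_ext (words (Suc n)) (tensor_id n \<pi>) \<subseteq>\<^sub>m ideal_ext (words n) \<pi>"
    unfolding ideal_ext_tensor_id by (rule map_leI) (simp add: restrict_map_def split: if_splits)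
qed

lemma represented_hom:
  "represented (words n) \<in> hom (ZA n) (Gk1 :: ('a::{finite,linorder} list \<rightharpoonup> 'a list) monoid)"
proof (rule homI)
  fix \<pi> :: "'a list \<Rightarrow> 'a list" assume \<pi>: "\<pi> \<in> carrier (ZA n)"
  then show "represented (words n) \<pi> \<in> carrier Gk1"
    unfolding represented_def by (intro max_ext_in_Gk1 fg_essential_iso_ideal_ext_ZA)
  fix \<rho> :: "'a list \<Rightarrow> 'a list" assume \<rho>: "\<rho> \<in> carrier (ZA n)"
  have "\<pi> \<otimes>\<^bsub>ZA n\<^esub> \<rho> = compose (words n) \<pi> \<rho>"
    using ZA_imp_Bij[OF \<pi>] ZA_imp_Bij[OF \<rho>] by (simp add: ZA_def BijGroup_def)
  moreover have "\<rho> ` words n \<subseteq> words n"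
    using length_ZA_apply[OF \<rho>] by (auto simp: in_words_iff)
  ultimately show "represented (words n) (\<pi> \<otimes>\<^bsub>ZA n\<^esub> \<rho>) =
      represented (words n) \<pi> \<otimes>\<^bsub>Gk1\<^esub> represented (words n) \<rho>"
    unfolding represented_def
    using max_ext_mult_max_ext[OF fg_essential_iso_ideal_ext_ZA[OF \<pi>] fg_essential_iso_ideal_ext_ZA[OF \<rho>]]
    by (simp add: ideal_ext_comp)
qed

text \<open>Maximal extension may add shorter words to the domain but keeps the explicit values on
  words of length at least \<open>n\<close>.\<close>

lemma represented_apply:
  assumes "\<pi> \<in> carrier (ZA n)" "length w = n"
  shows "represented (words n) \<pi> (w @ u) = Some (\<pi> w @ u)"
proof -
  have "essential_iso (ideal_ext (words n) \<pi>)"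
    using fg_essential_iso_ideal_ext_ZA[OF assms(1)] fg_essential_iso_iff by blast
  note le = max_ext(2)[OF this]
  have "ideal_ext (words n) \<pi> (w @ u) = Some (\<pi> w @ u)" by (simp add: ideal_ext_words assms(2))
  then show ?thesis unfolding represented_def by (rule map_leD[OF le])
qed

lemma inj_on_represented: "inj_on (represented (words n)) (carrier (ZA n))"
proof (rule inj_onI)
  fix \<pi> \<rho> :: "'a list \<Rightarrow> 'a list"
  assume \<pi>: "\<pi> \<in> carrier (ZA n)" and \<rho>: "\<rho> \<in> carrier (ZA n)"
    and eq: "represented (words n) \<pi> = represented (words n) \<rho>"
  show "\<pi> = \<rho>"
  proof (rule extensionalityI)
    show "\<pi> \<in> extensional (words n)" "\<rho> \<in> extensional (words n)"
      using \<pi> \<rho> by (simp_all add: Bij_imp_extensional ZA_imp_Bij)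
    fix w :: "'a list" assume "w \<in> words n"
    then show "\<pi> w = \<rho> w"
      using represented_apply[OF \<pi>, of w "[]"] represented_apply[OF \<rho>, of w "[]"] eq
      by (simp add: words_def)
  qed
qed

section \<open>The represented rotations are exactly the elements of \<open>lpT\<close>\<close>

lemma represented_lpG:
  assumes "\<pi> \<in> carrier (ZA n)"
  shows "represented (words n) \<pi> \<in> lpG"
  unfolding lpG_def
proof (intro CollectI conjI ballI)
  let ?\<phi> = "represented (words n) \<pi>"
  show \<phi>: "?\<phi> \<in> carrier Gk1" by (rule hom_in_carrier[OF represented_hom assms])
  then have e: "essential_iso ?\<phi>" by (simp add: Gk1_carrier_iff maximally_extended_def)
  fix x assume "x \<in> dom ?\<phi>"
  then obtain y where y: "?\<phi> x = Some y" by blast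
  \<comment> \<open>\<open>x\<close> may be shorter than \<open>n\<close>. After padding by
    \<open>n\<close> letters the explicit formula applies, and the padding adds equally to both
    lengths.\<close>
  define z where "z = replicate n (undefined :: 'a)"
  have l: "length (take n (x @ z)) = n" by (simp add: z_def)
  have "length (\<pi> (take n (x @ z))) = n"
    by (rule length_ZA_apply[OF assms l])
  moreover have "?\<phi> (x @ z) = Some (\<pi> (take n (x @ z)) @ drop n (x @ z))"
    using represented_apply[OF assms l, of "drop n (x @ z)"] unfolding append_take_drop_id .
  then have "y @ z = \<pi> (take n (x @ z)) @ drop n (x @ z)"
    using essential_isoD(4)[OF e y, of z] by simp
  ultimately have "length (y @ z) = length (x @ z)" by (simp add: z_def)
  then show "length (the (?\<phi> x)) = length x" using y by simp
qed

text \<open>On \<open>word_list N\<close> the map acts as a rotation, and rotations carry the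
  rotated listings onto themselves. Since expansion commutes with the map, the test transfers in
  both directions.\<close>

lemma represented_Tk1:
  fixes \<pi> :: "'a::{finite,linorder} list \<Rightarrow> 'a list"
  assumes "\<pi> \<in> carrier (ZA n)"
  shows "represented (words n) \<pi> \<in> Tk1"
  unfolding Tk1_def
proof (intro CollectI conjI allI impI)
  let ?\<phi> = "represented (words n) \<pi>"
  let ?f = "\<lambda>x. the (?\<phi> x)"
  show "?\<phi> \<in> carrier Gk1" by (rule hom_in_carrier[OF represented_hom assms])
  then have e: "essential_iso ?\<phi>" by (simp add: Gk1_carrier_iff maximally_extended_def)
  have len: "length (?f x) = length x" if "x \<in> dom ?\<phi>" for x
    using represented_lpG[OF assms] that by (simp add: lpG_def)
  fix xs assume xs: "set xs \<subseteq> dom ?\<phi>"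
  \<comment> \<open>\<open>N\<close> bounds \<open>n\<close>, so the explicit formula covers
    \<open>words N\<close>, and it bounds every entry of \<open>xs\<close>, so the test by expansion
    applies.\<close>
  define N where "N = n + sum_list (map length xs)"
  have N: "length x \<le> N" if "x \<in> set xs" for x
    using member_le_sum_list[of "length x" "map length xs"] that by (simp add: N_def)
  let ?W = "word_list N :: 'a list list"
  obtain m where m: "\<pi> = word_rotation n m" using assms by (auto simp: carrier_ZA)
  have "map ?f (expand N (word_list n)) = expand N (map \<pi> (word_list n))"
  proof (rule expand_map[symmetric])
    fix x :: "'a list" assume "x \<in> set (word_list n)"
    then have x: "length x = n" by (simp add: words_def)
    then show "?f (x @ u) = \<pi> x @ u" for u by (simp add: represented_apply[OF assms])
    show "length (\<pi> x) = length x"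
      using x length_ZA_apply[OF assms] by simp
  qed
  also have "map \<pi> (word_list n) = rotate m (word_list n)" unfolding m by (rule map_word_rotation)
  finally have mW: "map ?f ?W = expand N (rotate m (word_list n))"
    by (simp add: expand_word_list N_def)
  obtain l where "expand N (rotate m (word_list n)) = rotate l (expand N (word_list n :: 'a list list))"
    using expand_rotate by blast
  then have l: "map ?f ?W = rotate l ?W" unfolding mW by (simp add: expand_word_list N_def)
  \<comment> \<open>The opposite rotation as a natural number, for the way back from the image list
    to \<open>xs\<close>.\<close>
  define r where "r = l * length ?W - l"
  have "l * 1 \<le> l * length ?W" by (rule mult_le_mono2) (simp add: Suc_le_eq)
  then have "r + l = l * length ?W" by (simp add: r_def)
  then have "rotate r (rotate l ?W) = ?W" unfolding rotate_rotate by (intro rotate_id) simp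
  then have r: "?W = map ?f (rotate r ?W)" unfolding l[symmetric] rotate_map by (rule sym)
  have f: "map ?f (expand N xs) = expand N (map ?f xs)"
  proof (rule expand_map[symmetric])
    fix x assume x: "x \<in> set xs"
    then obtain y where y: "?\<phi> x = Some y" using xs by blast
    then show "?f (x @ u) = ?f x @ u" for u using essential_isoD(4)[OF e y] by simp
    show "length (?f x) = length x" using x xs len by blast
  qed
  have sub: "set (expand N xs) \<subseteq> words N" using set_expand[of xs N] N by auto
  have inj: "inj_on ?f (words N)"
  proof (rule inj_onI)
    have d: "\<exists>y. ?\<phi> x = Some y" if "x \<in> words N" for x
      using represented_apply[OF assms, of "take n x" "drop n x"] that by (simp add: words_def N_def)
    fix x y assume "x \<in> words N" "y \<in> words N" "?f x = ?f y"
    then have "?\<phi> x = Some (?f x)" "?\<phi> y = Some (?f x)" using d[of x] d[of y] by auto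
    then show "x = y" by (rule essential_isoD(3)[OF e])
  qed
  have "(\<exists>j. expand N xs = rotate j ?W) \<longleftrightarrow> (\<exists>j. map ?f (expand N xs) = rotate j ?W)"
  proof
    assume "\<exists>j. expand N xs = rotate j ?W"
    then obtain j where "expand N xs = rotate j ?W" by blast
    then have "map ?f (expand N xs) = rotate (j + l) ?W"
      by (simp only: rotate_map[symmetric] l rotate_rotate)
    then show "\<exists>j. map ?f (expand N xs) = rotate j ?W" by blast
  next
    assume "\<exists>j. map ?f (expand N xs) = rotate j ?W"
    then obtain j where j: "map ?f (expand N xs) = rotate j ?W" by blast
    also have "rotate j ?W = map ?f (rotate (j + r) ?W)"
      by (subst r) (simp only: rotate_map rotate_rotate)
    finally have "expand N xs = rotate (j + r) ?W"
      by (rule map_inj_on) (rule inj_on_subset[OF inj], use sub in simp)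
    then show "\<exists>j. expand N xs = rotate j ?W" by blast
  qed
  moreover have "is_code_cycle xs \<longleftrightarrow> (\<exists>j. expand N xs = rotate j ?W)"
    by (rule is_code_cycle_iff[OF N])
  moreover have "is_code_cycle (map ?f xs) \<longleftrightarrow> (\<exists>j. expand N (map ?f xs) = rotate j ?W)"
  proof (rule is_code_cycle_iff)
    fix y assume "y \<in> set (map ?f xs)"
    then obtain x where x: "x \<in> set xs" "y = ?f x" by auto
    then have "length y = length x" using len[of x] xs by auto
    then show "length y \<le> N" using N[OF x(1)] by simp
  qed
  ultimately show "is_code_cycle xs \<longleftrightarrow> is_code_cycle (map ?f xs)" unfolding f by blast
qed

text \<open>One instance of the cyclic condition suffices: the listing of a full level
  \<open>words n\<close> inside the domain. Its image is a code cycle of words of length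
  \<open>n\<close>, hence a rotation of the listing, and maximality of \<open>\<phi>\<close> does
  the rest.\<close>

lemma Tk1_lpG_represented:
  fixes \<phi> :: "'a::{finite,linorder} list \<rightharpoonup> 'a list"
  assumes "\<phi> \<in> Tk1" "\<phi> \<in> lpG"
  shows "\<exists>n. \<exists>\<pi>\<in>carrier (ZA (Suc n)). \<phi> = represented (words (Suc n)) \<pi>"
proof -
  let ?f = "\<lambda>x. the (\<phi> x)"
  have len: "length (?f x) = length x" if "x \<in> dom \<phi>" for x
    using assms(2) that by (simp add: lpG_def)
  have \<phi>: "fg_essential_iso \<phi>" "maximally_extended \<phi>"
    using assms(2) by (auto simp: lpG_def Gk1_carrier_iff)
  have e: "essential_iso \<phi>" using \<phi>(2) by (simp add: maximally_extended_def)
  obtain n' where n': "\<And>w. n' \<le> length w \<Longrightarrow> w \<in> dom \<phi>" using fg_essential_isoD[OF \<phi>(1)] by blast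
  \<comment> \<open>The successor makes the length positive, as the sequence starts at words of
    length one.\<close>
  define n where "n = Suc n'"
  let ?W = "word_list n :: 'a list list"
  have dom: "w \<in> dom \<phi>" if "length w = n" for w using n' that by (simp add: n_def)
  have "?W = rotate 0 (sorted_list_of_set (words n))" by (simp add: word_list_def)
  then have "is_code_cycle ?W"
    unfolding is_code_cycle_def cyclical_order_def
    by (intro exI[of _ "words n"] conjI exI[of _ 0] finite_words max_prefix_code_words)
  moreover have "set ?W \<subseteq> dom \<phi>" using dom unfolding set_word_list in_words_iff[symmetric] by blast
  moreover have "\<forall>xs. set xs \<subseteq> dom \<phi> \<longrightarrow> (is_code_cycle xs \<longleftrightarrow> is_code_cycle (map ?f xs))"
    using assms(1) by (simp add: Tk1_def)
  ultimately have cycle: "is_code_cycle (map ?f ?W)" by blast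
  have short: "length y \<le> n" if "y \<in> set (map ?f ?W)" for y
  proof -
    obtain w where "length w = n" "y = ?f w"
      using \<open>y \<in> set (map ?f ?W)\<close> by (auto simp: in_words_iff)
    then show ?thesis using len[OF dom] by simp
  qed
  obtain j where j: "expand n (map ?f ?W) = rotate j ?W"
    using iffD1[OF is_code_cycle_iff[OF short] cycle] by blast
  \<comment> \<open>The only extension of length \<open>n\<close> of a word of length
    \<open>n\<close> is the word itself, so this expansion changes nothing.\<close>
  have "expand n (map ?f ?W) = map ?f (expand n ?W)"
  proof (rule expand_map)
    fix x u :: "'a list" assume "x \<in> set ?W"
    then have x: "length x = n" by (simp add: in_words_iff)
    show "length (?f x) = length x" by (rule len[OF dom[OF x]])
    assume "length u = n - length x"
    then show "?f (x @ u) = ?f x @ u" using x by simp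
  qed
  then have "map ?f ?W = rotate j ?W" using j by (simp add: expand_word_list)
  moreover have "map (restrict ?f (words n)) ?W = map ?f ?W" by simp
  ultimately have \<pi>: "restrict ?f (words n) = word_rotation n j"
    by (intro word_rotation_unique) simp_all
  then have ZA: "restrict ?f (words n) \<in> carrier (ZA n)" by (simp add: carrier_ZA)
  have "ideal_ext (words n) (restrict ?f (words n)) \<subseteq>\<^sub>m \<phi>"
  proof (rule map_leI)
    fix w y assume "ideal_ext (words n) (restrict ?f (words n)) w = Some y"
    then have w: "n \<le> length w" "y = ?f (take n w) @ drop n w"
      by (auto simp: ideal_ext_words in_words_iff split: if_splits)
    then have "take n w \<in> dom \<phi>" by (intro dom) simp
    then have "\<phi> (take n w) = Some (?f (take n w))" by auto
    from essential_isoD(4)[OF e this, of "drop n w"] show "\<phi> w = Some y" using w by simp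
  qed
  moreover have "essential_iso (ideal_ext (words n) (restrict ?f (words n)))"
    using fg_essential_iso_ideal_ext_ZA[OF ZA] fg_essential_iso_iff by blast
  ultimately have "represented (words n) (restrict ?f (words n)) = \<phi>"
    unfolding represented_def by (intro max_ext_unique \<phi>(2))
  then have "\<phi> = represented (words (Suc n')) (restrict ?f (words n))" unfolding n_def by (rule sym)
  then show ?thesis using ZA unfolding n_def by (intro exI[of _ n'] bexI)
qed

lemma Tk1_Int_lpG:
  "Tk1 \<inter> lpG = (\<Union>n. represented (words (Suc n)) ` carrier (ZA (Suc n)))"
proof (intro equalityI subsetI)
  fix \<phi> :: "'a list \<rightharpoonup> 'a list"
  assume "\<phi> \<in> Tk1 \<inter> lpG"
  then obtain n \<pi> where "\<pi> \<in> carrier (ZA (Suc n))" "\<phi> = represented (words (Suc n)) \<pi>"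
    using Tk1_lpG_represented[of \<phi>] by auto
  then show "\<phi> \<in> (\<Union>n. represented (words (Suc n)) ` carrier (ZA (Suc n)))" by auto
next
  fix \<phi> :: "'a list \<rightharpoonup> 'a list"
  assume "\<phi> \<in> (\<Union>n. represented (words (Suc n)) ` carrier (ZA (Suc n)))"
  then obtain n \<pi> where "\<pi> \<in> carrier (ZA (Suc n))" "\<phi> = represented (words (Suc n)) \<pi>" by auto
  then show "\<phi> \<in> Tk1 \<inter> lpG" using represented_Tk1[of \<pi>] represented_lpG[of \<pi>] by simp
qed

section \<open>The Pruefer group\<close>

lemma group_prufer:
  assumes "k > 0"
  shows "group (prufer k)"
proof (rule groupI)
  show "x \<otimes>\<^bsub>prufer k\<^esub> y \<in> carrier (prufer k)"
    if "x \<in> carrier (prufer k)" "y \<in> carrier (prufer k)" for x y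
  proof -
    obtain m n where mn: "m > 0" "n > 0" "x ^ (k ^ m) = 1" "y ^ (k ^ n) = 1"
      using \<open>x \<in> carrier (prufer k)\<close> \<open>y \<in> carrier (prufer k)\<close> by (auto simp: prufer_def)
    \<comment> \<open>\<open>k^(m+n)\<close> is a common multiple of both exponents.\<close>
    have "(x * y) ^ (k ^ (m + n)) = (x ^ (k ^ m)) ^ (k ^ n) * (y ^ (k ^ n)) ^ (k ^ m)"
      by (simp add: power_mult_distrib power_add mult.commute flip: power_mult)
    also have "\<dots> = 1" using mn by simp
    finally show ?thesis using mn by (auto simp: prufer_def intro!: exI[of _ "m + n"])
  qed
  show "\<exists>y\<in>carrier (prufer k). y \<otimes>\<^bsub>prufer k\<^esub> x = \<one>\<^bsub>prufer k\<^esub>" if "x \<in> carrier (prufer k)" for x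
  proof -
    obtain n where n: "n > 0" "x ^ (k ^ n) = 1"
      using \<open>x \<in> carrier (prufer k)\<close> by (auto simp: prufer_def)
    then have "x \<noteq> 0" using assms by (auto simp: power_0_left)
    show ?thesis
    proof
      show "inverse x \<in> carrier (prufer k)" using n by (auto simp: prufer_def power_inverse)
      show "inverse x \<otimes>\<^bsub>prufer k\<^esub> x = \<one>\<^bsub>prufer k\<^esub>" using \<open>x \<noteq> 0\<close> by (simp add: prufer_def)
    qed
  qed
qed (auto simp: prufer_def)

section \<open>Rotations as roots of unity\<close>

definition root_of_unity :: "nat \<Rightarrow> complex" where
  "root_of_unity N = cis (2 * pi / real N)"

lemma root_of_unity_power: "root_of_unity N ^ m = cis (2 * pi * real m / real N)"
  by (simp add: root_of_unity_def DeMoivre mult.commute)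

lemma root_of_unity_power_self: "N > 0 \<Longrightarrow> root_of_unity N ^ N = 1"
  by (simp add: root_of_unity_power)

lemma root_of_unity_power_mod: "N > 0 \<Longrightarrow> root_of_unity N ^ (m mod N) = root_of_unity N ^ m"
proof -
  assume N: "N > 0"
  have "root_of_unity N ^ m = root_of_unity N ^ (N * (m div N) + m mod N)" by simp
  also have "\<dots> = root_of_unity N ^ (m mod N)"
    unfolding power_add power_mult root_of_unity_power_self[OF N] by simp
  finally show ?thesis by simp
qed

lemma bij_betw_root_of_unity_power:
  "N > 0 \<Longrightarrow> bij_betw (\<lambda>m. root_of_unity N ^ m) {..<N} {z. z ^ N = 1}"
  unfolding root_of_unity_power by (rule bij_betw_roots_unity)

lemma root_of_unity_power_eq_iff:
  assumes "N > 0"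
  shows "root_of_unity N ^ m = root_of_unity N ^ m' \<longleftrightarrow> m mod N = m' mod N"
proof
  assume "root_of_unity N ^ m = root_of_unity N ^ m'"
  then have "root_of_unity N ^ (m mod N) = root_of_unity N ^ (m' mod N)"
    by (simp only: root_of_unity_power_mod[OF assms])
  then show "m mod N = m' mod N"
    using bij_betw_root_of_unity_power[OF assms] assms unfolding bij_betw_def inj_on_def by simp
qed (metis root_of_unity_power_mod[OF assms])

lemma ex_root_of_unity_power:
  assumes "N > 0" "z ^ N = 1"
  shows "\<exists>m. z = root_of_unity N ^ m"
proof -
  have "z \<in> (\<lambda>m. root_of_unity N ^ m) ` {..<N}"
    using bij_betw_root_of_unity_power[OF assms(1)] assms(2) unfolding bij_betw_def by simp
  then show ?thesis by blast
qed

text \<open>The character taking rotation by \<open>m\<close> to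
  \<open>exp (2 pi i m / k^n)\<close>. The choice of \<open>m\<close> is immaterial: it is
  determined modulo \<open>k^n\<close>, the order of the root.\<close>

definition rotation_root :: "nat \<Rightarrow> ('a::{finite,linorder} list \<Rightarrow> 'a list) \<Rightarrow> complex" where
  "rotation_root n \<pi> = root_of_unity (CARD('a) ^ n) ^ (SOME m. \<pi> = word_rotation n m)"

lemma rotation_root_word_rotation:
  "rotation_root n (word_rotation n m :: 'a::{finite,linorder} list \<Rightarrow> 'a list) = root_of_unity (CARD('a) ^ n) ^ m"
proof -
  let ?r = "word_rotation n :: nat \<Rightarrow> 'a list \<Rightarrow> 'a list"
  have "?r m = ?r (SOME m'. ?r m = ?r m')" by (rule someI[of _ m]) simp
  then show ?thesis
    unfolding rotation_root_def word_rotation_eq_iff by (subst root_of_unity_power_eq_iff) simp_all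
qed

lemma rotation_root_cocone:
  "direct_limit_cocone (\<lambda>n. ZA (Suc n) :: ('a::{finite,linorder} list \<Rightarrow> 'a list) monoid)
    (\<lambda>n. tensor_id (Suc n)) (prufer CARD('a)) (\<lambda>n. rotation_root (Suc n))"
proof (rule direct_limit_cocone.intro)
  let ?r = "\<lambda>n. word_rotation n :: nat \<Rightarrow> 'a list \<Rightarrow> 'a list"
  fix n
  have N: "CARD('a) ^ n > 0" for n by simp
  show "group (ZA (Suc n) :: ('a list \<Rightarrow> 'a list) monoid)" by (rule group_ZA)
  show "group (prufer CARD('a))" by (rule group_prufer) simp
  show "tensor_id (Suc n) \<in> hom (ZA (Suc n) :: ('a list \<Rightarrow> 'a list) monoid) (ZA (Suc (Suc n)))"
    using tensor_id_mon unfolding mon_def by blast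
  show "rotation_root (Suc n) \<in> hom (ZA (Suc n) :: ('a list \<Rightarrow> 'a list) monoid) (prufer CARD('a))"
  proof (rule homI)
    fix \<pi> :: "'a list \<Rightarrow> 'a list" assume "\<pi> \<in> carrier (ZA (Suc n))"
    then obtain m where m: "\<pi> = ?r (Suc n) m" by (auto simp: carrier_ZA)
    have "(root_of_unity (CARD('a) ^ Suc n) ^ m) ^ (CARD('a) ^ Suc n) = 1"
      unfolding power_mult[symmetric] mult.commute[of m]
      unfolding power_mult root_of_unity_power_self[OF N] by simp
    then show "rotation_root (Suc n) \<pi> \<in> carrier (prufer CARD('a))"
      unfolding m rotation_root_word_rotation prufer_def by auto
    fix \<rho> :: "'a list \<Rightarrow> 'a list" assume "\<rho> \<in> carrier (ZA (Suc n))"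
    then obtain l where l: "\<rho> = ?r (Suc n) l" by (auto simp: carrier_ZA)
    show "rotation_root (Suc n) (\<pi> \<otimes>\<^bsub>ZA (Suc n)\<^esub> \<rho>) =
        rotation_root (Suc n) \<pi> \<otimes>\<^bsub>prufer CARD('a)\<^esub> rotation_root (Suc n) \<rho>"
      unfolding m l ZA_mult rotation_root_word_rotation by (simp add: prufer_def power_add)
  qed
  show "inj_on (rotation_root (Suc n)) (carrier (ZA (Suc n) :: ('a list \<Rightarrow> 'a list) monoid))"
    unfolding inj_on_def carrier_ZA
    by (auto simp del: power_Suc simp: rotation_root_word_rotation word_rotation_eq_iff root_of_unity_power_eq_iff)
  fix \<pi> :: "'a list \<Rightarrow> 'a list" assume "\<pi> \<in> carrier (ZA (Suc n))"
  then obtain m where m: "\<pi> = ?r (Suc n) m" by (auto simp: carrier_ZA)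
  \<comment> \<open>The fractions \<open>(m * k) / k^(n+2)\<close> and \<open>m / k^(n+1)\<close>
    agree.\<close>
  have "root_of_unity (CARD('a) ^ Suc (Suc n)) ^ (m * CARD('a)) = root_of_unity (CARD('a) ^ Suc n) ^ m"
    by (simp add: root_of_unity_power field_simps)
  then show "rotation_root (Suc (Suc n)) (tensor_id (Suc n) \<pi>) = rotation_root (Suc n) \<pi>"
    unfolding m tensor_id_word_rotation rotation_root_word_rotation .
qed

lemma represented_cocone:
  "direct_limit_cocone (\<lambda>n. ZA (Suc n) :: ('a::{finite,linorder} list \<Rightarrow> 'a list) monoid)
    (\<lambda>n. tensor_id (Suc n)) Gk1 (\<lambda>n. represented (words (Suc n)))"
proof (rule direct_limit_cocone.intro)
  show "tensor_id (Suc n) \<in> hom (ZA (Suc n) :: ('a list \<Rightarrow> 'a list) monoid) (ZA (Suc (Suc n)))" for n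
    using tensor_id_mon unfolding mon_def by blast
qed (rule group_ZA group_Gk1 represented_hom inj_on_represented represented_tensor_id; assumption?)+

lemma rotation_root_image:
  "(\<Union>n. rotation_root (Suc n) ` carrier (ZA (Suc n) :: ('a::{finite,linorder} list \<Rightarrow> 'a list) monoid)) =
   carrier (prufer CARD('a))"
proof
  interpret direct_limit_cocone "\<lambda>n. ZA (Suc n) :: ('a list \<Rightarrow> 'a list) monoid"
    "\<lambda>n. tensor_id (Suc n)" "prufer CARD('a)" "\<lambda>n. rotation_root (Suc n)"
    by (rule rotation_root_cocone)
  show "(\<Union>n. rotation_root (Suc n) ` carrier (ZA (Suc n) :: ('a list \<Rightarrow> 'a list) monoid)) \<subseteq>
      carrier (prufer CARD('a))"
    using hom_in_carrier[OF R_hom] by blast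
  show "carrier (prufer CARD('a)) \<subseteq>
      (\<Union>n. rotation_root (Suc n) ` carrier (ZA (Suc n) :: ('a list \<Rightarrow> 'a list) monoid))"
  proof
    fix z assume "z \<in> carrier (prufer CARD('a))"
    then obtain n' where "n' > 0" "z ^ (CARD('a) ^ n') = 1" by (auto simp: prufer_def)
    \<comment> \<open>A positive exponent is a successor, which is the index shift of the
      sequence.\<close>
    then obtain n where n: "z ^ (CARD('a) ^ Suc n) = 1" by (metis Suc_pred)
    then obtain m where "z = root_of_unity (CARD('a) ^ Suc n) ^ m"
      using ex_root_of_unity_power[OF _ n] by auto
    then have "z = rotation_root (Suc n) (word_rotation (Suc n) m :: 'a list \<Rightarrow> 'a list)"
      by (simp only: rotation_root_word_rotation)
    then show "z \<in> (\<Union>n. rotation_root (Suc n) ` carrier (ZA (Suc n) :: ('a list \<Rightarrow> 'a list) monoid))"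
      unfolding carrier_ZA by blast
  qed
qed

theorem proposition2p3:
  fixes k :: nat
  assumes "CARD('a::{finite,linorder}) = k" and "k \<ge> 2"
  shows
    "group (Gk1 :: ('a list \<rightharpoonup> 'a list) monoid) \<and>
     subgroup (Tk1 \<inter> lpG) (Gk1 :: ('a list \<rightharpoonup> 'a list) monoid) \<and>
     (lpT :: ('a list \<rightharpoonup> 'a list) monoid) \<cong> prufer k \<and>
     (\<forall>n\<ge>1. tensor_id n \<in> mon (ZA n :: ('a list \<Rightarrow> 'a list) monoid) (ZA (Suc n))) \<and>
     (\<forall>n\<ge>1. \<forall>\<pi>\<in>carrier (ZA n :: ('a list \<Rightarrow> 'a list) monoid).
        ideal_ext (words (Suc n)) (tensor_id n \<pi>) =
        ideal_ext (words n) \<pi> |` ideal_gen (words (Suc n))) \<and>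
     (\<exists>\<Phi> \<in> iso (direct_limit (\<lambda>n. ZA (Suc n)) (\<lambda>n. tensor_id (Suc n)))
               (lpT :: ('a list \<rightharpoonup> 'a list) monoid).
        \<forall>n. \<forall>\<pi>\<in>carrier (ZA (Suc n)).
          \<Phi> (dirlim_in (\<lambda>n. ZA (Suc n)) (\<lambda>n. tensor_id (Suc n)) n \<pi>) =
          represented (words (Suc n)) \<pi>)"
proof -
  let ?Z = "\<lambda>n. ZA (Suc n) :: ('a list \<Rightarrow> 'a list) monoid"
  let ?t = "\<lambda>n. tensor_id (Suc n) :: ('a list \<Rightarrow> 'a list) \<Rightarrow> 'a list \<Rightarrow> 'a list"
  let ?D = "direct_limit ?Z ?t"
  \<comment> \<open>Both cocones stand on the same sequence, so the two isomorphisms share the limit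
    \<open>?D\<close> and compose.\<close>
  interpret P: direct_limit_cocone ?Z ?t "prufer CARD('a)" "\<lambda>n. rotation_root (Suc n)"
    by (rule rotation_root_cocone)
  interpret R: direct_limit_cocone ?Z ?t Gk1 "\<lambda>n. represented (words (Suc n))"
    by (rule represented_cocone)
  have R: "R.image_carrier = Tk1 \<inter> lpG"
    unfolding R.image_carrier_def Tk1_Int_lpG ..
  \<comment> \<open>The characters exhaust the Pruefer group, so replacing its carrier by the union
    of the images changes nothing.\<close>
  have P: "(prufer CARD('a))\<lparr>carrier := P.image_carrier\<rparr> = prufer CARD('a)"
    unfolding P.image_carrier_def rotation_root_image by (simp add: prufer_def)
  have lpT: "Gk1\<lparr>carrier := R.image_carrier\<rparr> = lpT" by (simp add: R lpT_def)
  obtain \<Psi> where "\<Psi> \<in> iso ?D (prufer CARD('a))"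
    using P.direct_limit_iso unfolding P by auto
  then have "(lpT :: ('a list \<rightharpoonup> 'a list) monoid) \<cong> prufer CARD('a)"
    by (rule iso_trans[OF is_isoI[OF R.fibre_iso[unfolded lpT]] is_isoI])
  then have "(lpT :: ('a list \<rightharpoonup> 'a list) monoid) \<cong> prufer k" unfolding assms(1) .
  moreover have "subgroup (Tk1 \<inter> lpG) (Gk1 :: ('a list \<rightharpoonup> 'a list) monoid)"
    using R.subgroup_image_carrier unfolding R .
  moreover have "\<exists>\<Phi>\<in>iso ?D (lpT :: ('a list \<rightharpoonup> 'a list) monoid). \<forall>n. \<forall>\<pi>\<in>carrier (?Z n).
      \<Phi> (dirlim_in ?Z ?t n \<pi>) = represented (words (Suc n)) \<pi>"
    using R.direct_limit_iso unfolding lpT .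
  ultimately show ?thesis
    by (intro conjI allI impI ballI group_Gk1 tensor_id_mon ideal_ext_tensor_id)
qed

end
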